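(* Let $(\mathbb{A}_1,\mathbb{B}_1)$ and $(\mathbb{A}_2,\mathbb{B}_2)$ be restricted CSP templates in which $\mathbb{A}_1,\mathbb{A}_2$ are possibly infinite and $\mathbb{B}_1,\mathbb{B}_2$ are finite. The following are equivalent: (i) $(\mathbb{A}_1,\mathbb{B}_1)$ rpp-constructs $(\mathbb{A}_2,\mathbb{B}_2)$; (ii) $\mathbb{A}_1^{\mathbb{B}_1}$ pp-constructs $\mathbb{A}_2^{\mathbb{B}_2}$. In particular, $(\mathbb{A}_1,\mathbb{B}_1)$ and $(\mathbb{A}_1^{\mathbb{B}_1},\mathbb{L})$ rpp-construct each other, and $\mathrm{RCSP}(\mathbb{A}_1,\mathbb{B}_1)$ and $\mathrm{CSP}(\mathbb{A}_1^{\mathbb{B}_1})$ are log-space Turing-equivalent.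
   Context: A restricted CSP template is a pair $(\mathbb{A},\mathbb{B})$ of relational structures over a common finite relational signature whose CSPs are decidable. Homomorphisms, $\mathbb{A}\to\mathbb{B}$, homomorphic equivalence, and products $\mathbb{A}\times\mathbb{B}$ (domain $A\times B$, a tuple of pairs is in $R$ iff both coordinate tuples are) are as usual. $\mathrm{CSP}(\mathbb{B})$ is the problem of deciding $\mathbb{C}\to\mathbb{B}$ for finite $\mathbb{C}$. The loop $\mathbb{L}$ is the one-element structure $\{l\}$ with $(l,\dots,l)$ in every relation. $\mathrm{RCSP}(\mathbb{A},\mathbb{B})$ is the promise problem: given finite $\mathbb{C}$ promised to satisfy $\mathbb{C}\to\mathbb{B}$, decide whether $\mathbb{C}\to\mathbb{A}$. Exponential: for $\tau$-structures $\mathbb{A},\mathbb{B}$, $\mathbb{A}^{\mathbb{B}}$ has as domain all functions $B\to A$, and $(f_1,\dots,f_r)\in R^{\mathbb{A}^{\mathbb{B}}}$ iff $(f_1(b_1),\dots,f_r(b_r))\in R^{\mathbb{A}}$ for every $(b_1,\dots,b_r)\in R^{\mathbb{B}}$. A primitive positive (pp) formula has the form $\exists\bar y\,(\text{conjunction of atoms, including equalities})$. A pp-definition $\Delta$ of dimension $d$ of signature $\sigma$ in signature $\tau$ assigns to each $R\in\sigma$ of arity $r$ a pp $\tau$-formula $\delta_R$ with $rd$ free variables; the pp-power $\Pi_\Delta(\mathbb{A})$ of a $\tau$-structure $\mathbb{A}$ is the $\sigma$-structure on $A^d$ with $(\bar a_1,\dots,\bar a_r)\in R$ iff $\mathbb{A}\models\delta_R(\bar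 a_1,\dots,\bar a_r)$. $\mathbb{A}$ pp-constructs $\mathbb{A}'$ if $\Pi_\Delta(\mathbb{A})$ is homomorphically equivalent to $\mathbb{A}'$ for some $\Delta$. A template $(\mathbb{A},\mathbb{B})$ over $\tau$ rpp-constructs $(\mathbb{A}',\mathbb{B}')$ over $\sigma$ if for some pp-definition $\Delta$ of $\sigma$ in $\tau$, $\Pi_\Delta(\mathbb{A})\times\mathbb{B}'$ is homomorphically equivalent to $\mathbb{A}'\times\mathbb{B}'$ and $\mathbb{B}'\to\Pi_\Delta(\mathbb{B})$. *)

theory Defs
  imports Complex_Main "HOL-Library.FuncSet"
begin

section \<open>Relational structures\<close>

text \<open>
  A finite relational signature is the list of the arities of its symbols; the symbols are
  the indices \<open>i < length \<tau>\<close>.  Tuples are lists.  Empty domains and nullary symbols are allowed.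
\<close>

type_synonym signature = "nat list"

record 'a rel_structure =
  univ :: "'a set"
  rel :: "nat \<Rightarrow> 'a list set"

definition is_structure :: "signature \<Rightarrow> 'a rel_structure \<Rightarrow> bool" where
  "is_structure \<tau> A \<longleftrightarrow>
     (\<forall>i<length \<tau>. \<forall>t\<in>rel A i. length t = \<tau> ! i \<and> set t \<subseteq> univ A)"

definition is_hom :: "signature \<Rightarrow> 'a rel_structure \<Rightarrow> 'b rel_structure \<Rightarrow> ('a \<Rightarrow> 'b) \<Rightarrow> bool" where
  "is_hom \<tau> A B h \<longleftrightarrow>
     h ` univ A \<subseteq> univ B \<and> (\<forall>i<length \<tau>. \<forall>t\<in>rel A i. map h t \<in> rel B i)"

definition maps_to :: "signature \<Rightarrow> 'a rel_structure \<Rightarrow> 'b rel_structure \<Rightarrow> bool" where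
  "maps_to \<tau> A B \<longleftrightarrow> (\<exists>h. is_hom \<tau> A B h)"

definition hom_equivalent :: "signature \<Rightarrow> 'a rel_structure \<Rightarrow> 'b rel_structure \<Rightarrow> bool" where
  "hom_equivalent \<tau> A B \<longleftrightarrow> maps_to \<tau> A B \<and> maps_to \<tau> B A"

definition struct_product :: "'a rel_structure \<Rightarrow> 'b rel_structure \<Rightarrow> ('a \<times> 'b) rel_structure" where
  "struct_product A B =
     \<lparr>univ = univ A \<times> univ B,
      rel = (\<lambda>i. {t. map fst t \<in> rel A i \<and> map snd t \<in> rel B i})\<rparr>"

definition loop :: "signature \<Rightarrow> unit rel_structure" where
  "loop \<tau> = \<lparr>univ = {()}, rel = (\<lambda>i. {replicate (\<tau> ! i) ()})\<rparr>"

text \<open>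
  Functions from the domain of \<open>B\<close> to the domain of \<open>A\<close> are taken to be extensional, so that
  each of them is represented exactly once.
\<close>

definition exponential ::
    "signature \<Rightarrow> 'a rel_structure \<Rightarrow> 'b rel_structure \<Rightarrow> ('b \<Rightarrow> 'a) rel_structure" where
  "exponential \<tau> A B =
     \<lparr>univ = univ B \<rightarrow>\<^sub>E univ A,
      rel = (\<lambda>i. {fs. length fs = \<tau> ! i \<and> set fs \<subseteq> (univ B \<rightarrow>\<^sub>E univ A) \<and>
                      (\<forall>bs\<in>rel B i. map2 (\<lambda>f b. f b) fs bs \<in> rel A i)})\<rparr>"


section \<open>Primitive positive constructions\<close>

text \<open>
  Variables are numbers.  In a formula \<open>PP m \<phi>s\<close> with \<open>n\<close> free variables, the free variables are
  \<open>0, \<dots>, n - 1\<close>, the variables \<open>n, \<dots>, n + m - 1\<close> are existentially quantified, and \<open>\<phi>s\<close> is the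
  list of conjuncts.
\<close>

datatype pp_atom = RelAtom nat "nat list" | EqAtom nat nat

datatype pp_formula = PP nat "pp_atom list"

fun wf_atom :: "signature \<Rightarrow> nat \<Rightarrow> pp_atom \<Rightarrow> bool" where
  "wf_atom \<tau> k (RelAtom i vs) \<longleftrightarrow>
     i < length \<tau> \<and> length vs = \<tau> ! i \<and> (\<forall>v\<in>set vs. v < k)"
| "wf_atom \<tau> k (EqAtom u v) \<longleftrightarrow> u < k \<and> v < k"

fun wf_pp :: "signature \<Rightarrow> nat \<Rightarrow> pp_formula \<Rightarrow> bool" where
  "wf_pp \<tau> n (PP m \<phi>s) \<longleftrightarrow> (\<forall>\<phi>\<in>set \<phi>s. wf_atom \<tau> (n + m) \<phi>)"

fun sat_atom :: "'a rel_structure \<Rightarrow> 'a list \<Rightarrow> pp_atom \<Rightarrow> bool" where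
  "sat_atom A xs (RelAtom i vs) \<longleftrightarrow> map (\<lambda>v. xs ! v) vs \<in> rel A i"
| "sat_atom A xs (EqAtom u v) \<longleftrightarrow> xs ! u = xs ! v"

fun sat_pp :: "'a rel_structure \<Rightarrow> 'a list \<Rightarrow> pp_formula \<Rightarrow> bool" where
  "sat_pp A xs (PP m \<phi>s) \<longleftrightarrow>
     (\<exists>ys. length ys = m \<and> set ys \<subseteq> univ A \<and> (\<forall>\<phi>\<in>set \<phi>s. sat_atom A (xs @ ys) \<phi>))"

text \<open>
  Dimension \<open>0\<close> is allowed; over structures with nonempty domain it gives nothing new up to
  homomorphic equivalence, since an unconstrained coordinate can be added.
\<close>

definition is_pp_definition ::
    "signature \<Rightarrow> signature \<Rightarrow> nat \<Rightarrow> pp_formula list \<Rightarrow> bool" where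
  "is_pp_definition \<sigma> \<tau> d \<Delta> \<longleftrightarrow>
     length \<Delta> = length \<sigma> \<and> (\<forall>i<length \<sigma>. wf_pp \<tau> ((\<sigma> ! i) * d) (\<Delta> ! i))"

definition pp_power ::
    "signature \<Rightarrow> nat \<Rightarrow> pp_formula list \<Rightarrow> 'a rel_structure \<Rightarrow> 'a list rel_structure" where
  "pp_power \<sigma> d \<Delta> A =
     (let D = {v. length v = d \<and> set v \<subseteq> univ A} in
      \<lparr>univ = D,
       rel = (\<lambda>i. {vs. length vs = \<sigma> ! i \<and> set vs \<subseteq> D \<and> sat_pp A (concat vs) (\<Delta> ! i)})\<rparr>)"

definition pp_constructs ::
    "signature \<Rightarrow> 'a rel_structure \<Rightarrow> signature \<Rightarrow> 'b rel_structure \<Rightarrow> bool" where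
  "pp_constructs \<tau> A \<sigma> A' \<longleftrightarrow>
     (\<exists>d \<Delta>. is_pp_definition \<sigma> \<tau> d \<Delta> \<and> hom_equivalent \<sigma> (pp_power \<sigma> d \<Delta> A) A')"

fun rpp_constructs ::
    "signature \<Rightarrow> 'a rel_structure \<times> 'b rel_structure \<Rightarrow>
     signature \<Rightarrow> 'c rel_structure \<times> 'd rel_structure \<Rightarrow> bool" where
  "rpp_constructs \<tau> (A, B) \<sigma> (A', B') \<longleftrightarrow>
     (\<exists>d \<Delta>. is_pp_definition \<sigma> \<tau> d \<Delta> \<and>
        hom_equivalent \<sigma> (struct_product (pp_power \<sigma> d \<Delta> A) B') (struct_product A' B') \<and>
        maps_to \<sigma> B' (pp_power \<sigma> d \<Delta> B))"


section \<open>Oracle Turing machines\<close>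

datatype letter = One | Comma | Semicolon | Bar

type_synonym word = "letter list"

text \<open>
  The machines are deterministic and have a read-only input tape delimited by end markers, one
  work tape that is infinite to the right, and a write-only, append-only oracle tape.  On
  entering the query state the machine is told, by its next state, whether the content of the
  oracle tape belongs to the oracle, and the oracle tape is erased.  The states are
  \<open>{..<num_states}\<close>, the work symbols are \<open>{..<num_symbols}\<close>, and \<open>0\<close> is the blank.
\<close>

datatype input_symbol = LeftEnd | Letter letter | RightEnd

datatype move = MoveLeft | Stay | MoveRight

record machine =
  num_states :: nat
  num_symbols :: nat
  start_state :: nat
  accept_state :: nat
  reject_state :: nat
  query_state :: nat
  yes_state :: nat
  no_state :: nat
  trans :: "nat \<Rightarrow> input_symbol \<Rightarrow> nat \<Rightarrow> nat \<times> nat \<times> move \<times> move \<times> letter option"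
    \<comment> \<open>new state, symbol written, input move, work move, letter appended to the oracle tape\<close>

definition is_machine :: "machine \<Rightarrow> bool" where
  "is_machine M \<longleftrightarrow>
     {start_state M, accept_state M, reject_state M, query_state M, yes_state M, no_state M}
        \<subseteq> {..<num_states M} \<and>
     distinct [accept_state M, reject_state M, query_state M] \<and>
     0 < num_symbols M \<and>
     (\<forall>q<num_states M. \<forall>x. \<forall>s<num_symbols M.
        case trans M q x s of (q', s', _) \<Rightarrow> q' < num_states M \<and> s' < num_symbols M)"

record config =
  state :: nat
  input_pos :: nat
  work_pos :: nat
  work_tape :: "nat \<Rightarrow> nat"
  oracle_tape :: word

definition initial :: "machine \<Rightarrow> config" where
  "initial M = \<lparr>state = start_state M, input_pos = 0, work_pos = 0,
                work_tape = (\<lambda>_. 0), oracle_tape = []\<rparr>"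

definition read_input :: "word \<Rightarrow> nat \<Rightarrow> input_symbol" where
  "read_input w p =
     (if p = 0 then LeftEnd else if p \<le> length w then Letter (w ! (p - 1)) else RightEnd)"

fun move_pos :: "move \<Rightarrow> nat \<Rightarrow> nat" where
  "move_pos MoveLeft p = p - 1"
| "move_pos Stay p = p"
| "move_pos MoveRight p = p + 1"

text \<open>Halting configurations are fixed points of the step function.\<close>

definition step :: "machine \<Rightarrow> word set \<Rightarrow> word \<Rightarrow> config \<Rightarrow> config" where
  "step M X w c =
     (if state c = accept_state M \<or> state c = reject_state M then c
      else if state c = query_state M then
        c\<lparr>state := (if oracle_tape c \<in> X then yes_state M else no_state M), oracle_tape := []\<rparr>
      else
        (case trans M (state c) (read_input w (input_pos c)) (work_tape c (work_pos c)) of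
           (q, s, mi, mw, l) \<Rightarrow>
             \<lparr>state = q,
              input_pos = min (move_pos mi (input_pos c)) (length w + 1),
              work_pos = move_pos mw (work_pos c),
              work_tape = (work_tape c)(work_pos c := s),
              oracle_tape = oracle_tape c @ (case l of None \<Rightarrow> [] | Some a \<Rightarrow> [a])\<rparr>))"

definition config_at :: "machine \<Rightarrow> word set \<Rightarrow> word \<Rightarrow> nat \<Rightarrow> config" where
  "config_at M X w t = (step M X w ^^ t) (initial M)"

definition accepts :: "machine \<Rightarrow> word set \<Rightarrow> word \<Rightarrow> bool" where
  "accepts M X w \<longleftrightarrow> (\<exists>t. state (config_at M X w t) = accept_state M)"

definition rejects :: "machine \<Rightarrow> word set \<Rightarrow> word \<Rightarrow> bool" where
  "rejects M X w \<longleftrightarrow> (\<exists>t. state (config_at M X w t) = reject_state M)"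

text \<open>Only the work tape counts towards the space used.\<close>

definition log_space :: "real \<Rightarrow> machine \<Rightarrow> word set \<Rightarrow> bool" where
  "log_space K M X \<longleftrightarrow>
     (\<forall>w t. real (work_pos (config_at M X w t)) \<le> K * log 2 (real (length w) + 2))"


section \<open>Promise problems and log-space Turing reductions\<close>

record problem =
  yes_words :: "word set"
  no_words :: "word set"

definition machine_solves :: "machine \<Rightarrow> word set \<Rightarrow> problem \<Rightarrow> bool" where
  "machine_solves M X P \<longleftrightarrow>
     (\<forall>w\<in>yes_words P. accepts M X w) \<and> (\<forall>w\<in>no_words P. rejects M X w)"

text \<open>With the empty oracle every query is answered negatively, so this is plain decidability.\<close>

definition decidable :: "problem \<Rightarrow> bool" where
  "decidable P \<longleftrightarrow> (\<exists>M. is_machine M \<and> machine_solves M {} P)"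

definition oracle_for :: "word set \<Rightarrow> problem \<Rightarrow> bool" where
  "oracle_for X Q \<longleftrightarrow> yes_words Q \<subseteq> X \<and> no_words Q \<inter> X = {}"

text \<open>
  The reduction must work for every oracle that is correct on the promise of \<open>Q\<close>, whatever it
  answers to queries outside the promise.
\<close>

definition logspace_turing_reducible :: "problem \<Rightarrow> problem \<Rightarrow> bool" where
  "logspace_turing_reducible P Q \<longleftrightarrow>
     (\<exists>M K. is_machine M \<and> (\<forall>X. oracle_for X Q \<longrightarrow> log_space K M X \<and> machine_solves M X P))"

definition logspace_turing_equivalent :: "problem \<Rightarrow> problem \<Rightarrow> bool" where
  "logspace_turing_equivalent P Q \<longleftrightarrow>
     logspace_turing_reducible P Q \<and> logspace_turing_reducible Q P"


section \<open>Constraint satisfaction problems\<close>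

text \<open>
  An instance has domain \<open>{..<n}\<close> and is written down as \<open>n\<close> in unary followed, for each symbol
  of the signature, by a list without repetition of the tuples in the relation (in any order),
  with their entries in unary.  A word encodes at most one structure; words that encode none are
  not instances and are outside the promise.
\<close>

definition encode_tuple :: "nat list \<Rightarrow> word" where
  "encode_tuple t = concat (map (\<lambda>a. replicate a One @ [Comma]) t) @ [Semicolon]"

definition encode_relation :: "nat list list \<Rightarrow> word" where
  "encode_relation ts = concat (map encode_tuple ts) @ [Bar]"

definition encodes :: "signature \<Rightarrow> word \<Rightarrow> nat rel_structure \<Rightarrow> bool" where
  "encodes \<tau> w C \<longleftrightarrow> is_structure \<tau> C \<and>
     (\<exists>n tss. univ C = {..<n} \<and> length tss = length \<tau> \<and>
        (\<forall>i<length \<tau>. distinct (tss ! i) \<and> set (tss ! i) = rel C i) \<and>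
        w = replicate n One @ [Bar] @ concat (map encode_relation tss))"

definition CSP :: "signature \<Rightarrow> 'a rel_structure \<Rightarrow> problem" where
  "CSP \<tau> A =
     \<lparr>yes_words = {w. \<exists>C. encodes \<tau> w C \<and> maps_to \<tau> C A},
      no_words = {w. \<exists>C. encodes \<tau> w C \<and> \<not> maps_to \<tau> C A}\<rparr>"

definition RCSP :: "signature \<Rightarrow> 'a rel_structure \<Rightarrow> 'b rel_structure \<Rightarrow> problem" where
  "RCSP \<tau> A B =
     \<lparr>yes_words = {w. \<exists>C. encodes \<tau> w C \<and> maps_to \<tau> C B \<and> maps_to \<tau> C A},
      no_words = {w. \<exists>C. encodes \<tau> w C \<and> maps_to \<tau> C B \<and> \<not> maps_to \<tau> C A}\<rparr>"

fun restricted_template :: "signature \<Rightarrow> 'a rel_structure \<times> 'b rel_structure \<Rightarrow> bool" where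
  "restricted_template \<tau> (A, B) \<longleftrightarrow>
     is_structure \<tau> A \<and> is_structure \<tau> B \<and> decidable (CSP \<tau> A) \<and> decidable (CSP \<tau> B)"

end

theory Submission
  imports Defs
begin

text \<open>
  Everything rests on the adjunction \<open>C \<times> B \<rightarrow> A\<close> iff \<open>C \<rightarrow> A\<^bsup>B\<^esup>\<close>, so that for \<open>C \<rightarrow> B\<close> the conditions
  \<open>C \<rightarrow> A\<close> and \<open>C \<rightarrow> A\<^bsup>B\<^esup>\<close> agree.  A power \<open>\<Pi>(A)\<^bsup>B\<^esup>\<close> with finite \<open>B\<close> is a pp-power of \<open>A\<close>, with one
  block of coordinates per element of \<open>B\<close>; dually \<open>\<Pi>(A\<^bsup>B\<^esup>)\<close> is a pp-power of \<open>A\<close>, each variable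
  being replaced by the list of its values.  Given an rpp-construction \<open>\<Pi>\<close>, the constant maps
  \<open>A\<^sub>1 \<rightarrow> A\<^sub>1\<^bsup>B\<^sub>1\<^esup>\<close> and the evaluation \<open>\<Pi>(A\<^sub>1\<^bsup>B\<^sub>1\<^esup>) \<times> B\<^sub>2 \<rightarrow> \<Pi>(A\<^sub>1\<^bsup>B\<^sub>1\<^esup> \<times> B\<^sub>1) \<rightarrow> \<Pi>(A\<^sub>1)\<close> show that
  \<open>\<Pi>(A\<^sub>1\<^bsup>B\<^sub>1\<^esup>)\<^bsup>B\<^sub>2\<^esup>\<close> and \<open>\<Pi>(A\<^sub>1)\<^bsup>B\<^sub>2\<^esup>\<close> are homomorphically equivalent.

  For the complexity statement, one reduction is the identity and the other maps \<open>C\<close> to \<open>C \<times> B\<^sub>1\<close>.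
  Both can be written on the oracle tape by a two-way finite transducer, which needs no work tape.
\<close>

section \<open>Homomorphisms, products and exponentials\<close>

lemma is_hom_univ: "is_hom \<tau> A B h \<Longrightarrow> a \<in> univ A \<Longrightarrow> h a \<in> univ B"
  unfolding is_hom_def by blast

lemma is_hom_rel: "is_hom \<tau> A B h \<Longrightarrow> i < length \<tau> \<Longrightarrow> t \<in> rel A i \<Longrightarrow> map h t \<in> rel B i"
  unfolding is_hom_def by blast

lemma is_structureD:
  assumes "is_structure \<tau> A" and "i < length \<tau>" and "t \<in> rel A i"
  shows "length t = \<tau> ! i" and "set t \<subseteq> univ A"
  using assms unfolding is_structure_def by blast+

lemma maps_to_refl: "maps_to \<tau> A A"
  unfolding maps_to_def is_hom_def by (rule exI[of _ id]) simp

lemma maps_to_trans: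
  assumes "maps_to \<tau> A B" and "maps_to \<tau> B C"
  shows "maps_to \<tau> A C"
proof -
  obtain f g where "is_hom \<tau> A B f" "is_hom \<tau> B C g"
    using assms unfolding maps_to_def by blast
  then have "is_hom \<tau> A C (g \<circ> f)"
    unfolding is_hom_def by (fastforce simp flip: map_map)
  then show ?thesis unfolding maps_to_def by blast
qed

lemma hom_equivalent_sym: "hom_equivalent \<tau> A B \<Longrightarrow> hom_equivalent \<tau> B A"
  unfolding hom_equivalent_def by blast

lemma hom_equivalent_trans:
  "hom_equivalent \<tau> A B \<Longrightarrow> hom_equivalent \<tau> B C \<Longrightarrow> hom_equivalent \<tau> A C"
  unfolding hom_equivalent_def by (blast intro: maps_to_trans)

lemma product_maps_to_fst: "maps_to \<tau> (struct_product A B) A"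
  unfolding maps_to_def is_hom_def struct_product_def by (rule exI[of _ fst]) auto

lemma product_maps_to_snd: "maps_to \<tau> (struct_product A B) B"
  unfolding maps_to_def is_hom_def struct_product_def by (rule exI[of _ snd]) auto

lemma maps_to_product:
  assumes "maps_to \<tau> C A" and "maps_to \<tau> C B"
  shows "maps_to \<tau> C (struct_product A B)"
proof -
  obtain f g where "is_hom \<tau> C A f" "is_hom \<tau> C B g"
    using assms unfolding maps_to_def by blast
  then have "is_hom \<tau> C (struct_product A B) (\<lambda>x. (f x, g x))"
    unfolding is_hom_def struct_product_def by (auto simp: comp_def)
  then show ?thesis unfolding maps_to_def by blast
qed

lemma product_mono:
  "maps_to \<tau> A A' \<Longrightarrow> maps_to \<tau> B B' \<Longrightarrow> maps_to \<tau> (struct_product A B) (struct_product A' B')"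
  by (intro maps_to_product maps_to_trans[OF product_maps_to_fst] maps_to_trans[OF product_maps_to_snd])

section \<open>Well-formedness of products, exponentials, powers and loops\<close>

lemma is_structure_product:
  assumes "is_structure \<tau> A" and "is_structure \<tau> B"
  shows "is_structure \<tau> (struct_product A B)"
  unfolding is_structure_def
proof (intro allI impI ballI)
  fix i t assume i: "i < length \<tau>" and "t \<in> rel (struct_product A B) i"
  then have t: "map fst t \<in> rel A i" "map snd t \<in> rel B i"
    by (simp_all add: struct_product_def)
  have "length (map fst t) = \<tau> ! i" "set (map fst t) \<subseteq> univ A" "set (map snd t) \<subseteq> univ B"
    using is_structureD[OF assms(1) i t(1)] is_structureD[OF assms(2) i t(2)] by simp_all
  then show "length t = \<tau> ! i \<and> set t \<subseteq> univ (struct_product A B)"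
    by (simp add: struct_product_def image_subset_iff subset_iff mem_Times_iff)
qed

lemma is_structure_exponential: "is_structure \<tau> (exponential \<tau> A B)"
  unfolding is_structure_def exponential_def by auto

lemma is_structure_pp_power: "is_structure \<sigma> (pp_power \<sigma> d \<Delta> A)"
  unfolding is_structure_def pp_power_def Let_def by auto

lemma is_structure_loop: "is_structure \<tau> (loop \<tau>)"
  unfolding is_structure_def loop_def by auto

text \<open>Currying: a map \<open>h\<close> on the product corresponds to sending \<open>c\<close>
  to \<open>h (c, _)\<close>. A relation of the exponential tests a tuple of \<open>C\<close>
  against every tuple of \<open>B\<close>, which are the tuples of the product; both have the length
  given by the arity, so \<open>zip\<close> drops nothing.\<close>

lemma maps_to_exponential_iff:
  assumes C: "is_structure \<tau> C" and B: "is_structure \<tau> B"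
  shows "maps_to \<tau> C (exponential \<tau> A B) \<longleftrightarrow> maps_to \<tau> (struct_product C B) A"
proof
  assume "maps_to \<tau> C (exponential \<tau> A B)"
  then obtain F where F: "is_hom \<tau> C (exponential \<tau> A B) F"
    unfolding maps_to_def by blast
  have "is_hom \<tau> (struct_product C B) A (\<lambda>(c, b). F c b)"
    unfolding is_hom_def
  proof (intro conjI allI impI ballI)
    show "(\<lambda>(c, b). F c b) ` univ (struct_product C B) \<subseteq> univ A"
      using is_hom_univ[OF F] by (fastforce simp: struct_product_def exponential_def)
    fix i t assume i: "i < length \<tau>" and "t \<in> rel (struct_product C B) i"
    then have t: "map fst t \<in> rel C i" "map snd t \<in> rel B i"
      by (simp_all add: struct_product_def)
    then have "map F (map fst t) \<in> rel (exponential \<tau> A B) i"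
      using is_hom_rel[OF F i] by blast
    then have "map2 (\<lambda>f b. f b) (map F (map fst t)) (map snd t) \<in> rel A i"
      using t by (simp add: exponential_def)
    also have "map2 (\<lambda>f b. f b) (map F (map fst t)) (map snd t) = map (\<lambda>(c, b). F c b) t"
      by (induction t) auto
    finally show "map (\<lambda>(c, b). F c b) t \<in> rel A i" .
  qed
  then show "maps_to \<tau> (struct_product C B) A" unfolding maps_to_def by blast
next
  assume "maps_to \<tau> (struct_product C B) A"
  then obtain h where h: "is_hom \<tau> (struct_product C B) A h"
    unfolding maps_to_def by blast
  \<comment> \<open>Restricting to \<open>univ B\<close> puts \<open>F c\<close> among the
    extensional functions that form the exponential.\<close>
  define F where "F c = (\<lambda>b\<in>univ B. h (c, b))" for c
  have F: "F c \<in> univ B \<rightarrow>\<^sub>E univ A" if "c \<in> univ C" for c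
    using is_hom_univ[OF h] that unfolding F_def by (simp add: struct_product_def)
  have "is_hom \<tau> C (exponential \<tau> A B) F"
    unfolding is_hom_def
  proof (intro conjI allI impI ballI)
    show "F ` univ C \<subseteq> univ (exponential \<tau> A B)"
      using F by (auto simp: exponential_def)
    fix i t assume i: "i < length \<tau>" and t: "t \<in> rel C i"
    have lt: "length t = \<tau> ! i" "set t \<subseteq> univ C"
      using is_structureD[OF C i t] by blast+
    have "map2 (\<lambda>f b. f b) (map F t) bs \<in> rel A i" if bs: "bs \<in> rel B i" for bs
    proof -
      have lb: "length bs = \<tau> ! i" "set bs \<subseteq> univ B"
        using is_structureD[OF B i bs] by blast+
      have "zip t bs \<in> rel (struct_product C B) i"
        using t bs lt lb by (simp add: struct_product_def)
      then have "map h (zip t bs) \<in> rel A i"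
        using is_hom_rel[OF h i] by blast
      also have "map h (zip t bs) = map2 (\<lambda>f b. f b) (map F t) bs"
        using lt lb by (intro nth_equalityI) (auto simp: F_def subset_iff)
      finally show ?thesis .
    qed
    then show "map F t \<in> rel (exponential \<tau> A B) i"
      using lt F by (auto simp: exponential_def subset_iff simp del: PiE_iff)
  qed
  then show "maps_to \<tau> C (exponential \<tau> A B)" unfolding maps_to_def by blast
qed

text \<open>Evaluation is the transpose of the identity of the exponential.\<close>

lemma exponential_evaluation:
  "is_structure \<tau> B \<Longrightarrow> maps_to \<tau> (struct_product (exponential \<tau> A B) B) A"
  by (simp add: maps_to_refl flip: maps_to_exponential_iff[OF is_structure_exponential])

text \<open>The transpose of the first projection: each element goes to its constant map.\<close>

lemma maps_to_exponential:
  "is_structure \<tau> A \<Longrightarrow> is_structure \<tau> B \<Longrightarrow> maps_to \<tau> A (exponential \<tau> A B)"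
  by (simp add: maps_to_exponential_iff product_maps_to_fst)

text \<open>A map from \<open>C\<close> to \<open>B\<close> makes \<open>C\<close> homomorphically
  equivalent to its product with \<open>B\<close>, and the adjunction then removes the exponent.
  This is where the promise enters.\<close>

lemma maps_to_exponential_iff_restricted:
  assumes "is_structure \<tau> C" and "is_structure \<tau> B" and CB: "maps_to \<tau> C B"
  shows "maps_to \<tau> C (exponential \<tau> A B) \<longleftrightarrow> maps_to \<tau> C A"
  unfolding maps_to_exponential_iff[OF assms(1,2)]
  using maps_to_trans[OF maps_to_product[OF maps_to_refl CB], of A]
    maps_to_trans[OF product_maps_to_fst, of \<tau> C A B]
  by blast

text \<open>The given map may depend on \<open>B\<close>: after transposing, the element of
  \<open>B\<close> is available, so one evaluates at it, keeps it as second coordinate and applies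
  the given map.\<close>

lemma exponential_mono:
  assumes B: "is_structure \<tau> B" and h: "maps_to \<tau> (struct_product A B) A'"
  shows "maps_to \<tau> (exponential \<tau> A B) (exponential \<tau> A' B)"
  unfolding maps_to_exponential_iff[OF is_structure_exponential B]
  using maps_to_trans[OF maps_to_product[OF exponential_evaluation[OF B] product_maps_to_snd] h] .

text \<open>For each of the two directions, both sides amount to a map from the product of one
  structure with \<open>B\<close> to the other structure. This converts the product condition of an
  rpp-construction into one on exponentials.\<close>

lemma hom_equivalent_product_iff:
  assumes B: "is_structure \<tau> B" and A: "is_structure \<tau> A" "is_structure \<tau> A'"
  shows "hom_equivalent \<tau> (struct_product A B) (struct_product A' B) \<longleftrightarrow>
         hom_equivalent \<tau> (exponential \<tau> A B) (exponential \<tau> A' B)"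
proof -
  have *: "maps_to \<tau> (struct_product X B) (struct_product Y B) \<longleftrightarrow>
        maps_to \<tau> (exponential \<tau> X B) (exponential \<tau> Y B)" (is "?L \<longleftrightarrow> ?R")
    if X: "is_structure \<tau> X" for X :: "'x rel_structure" and Y :: "'y rel_structure"
  proof
    assume ?L
    then show ?R
      by (rule exponential_mono[OF B maps_to_trans[OF _ product_maps_to_fst]])
  next
    assume ?R
    then have "maps_to \<tau> X (exponential \<tau> Y B)"
      by (rule maps_to_trans[OF maps_to_exponential[OF X B]])
    then have "maps_to \<tau> (struct_product X B) Y"
      using maps_to_exponential_iff[OF X B] by blast
    then show ?L
      by (rule maps_to_product[OF _ product_maps_to_snd])
  qed
  show ?thesis unfolding hom_equivalent_def by (simp add: * A)
qed

lemma maps_to_loop: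
  assumes "is_structure \<tau> A"
  shows "maps_to \<tau> A (loop \<tau>)"
proof -
  have "is_hom \<tau> A (loop \<tau>) (\<lambda>_. ())"
    using assms by (auto simp: is_hom_def is_structure_def loop_def intro!: nth_equalityI)
  then show ?thesis unfolding maps_to_def by blast
qed

text \<open>Every structure maps to the loop, so the restricted equivalence applies to the
  exponential itself and turns its identity into a map to \<open>A\<close>. Constant maps give the
  converse.\<close>

lemma exponential_loop:
  assumes "is_structure \<tau> A"
  shows "hom_equivalent \<tau> (exponential \<tau> A (loop \<tau>)) A"
  unfolding hom_equivalent_def
  using maps_to_exponential[OF assms is_structure_loop]
    maps_to_exponential_iff_restricted[OF is_structure_exponential is_structure_loop
      maps_to_loop[OF is_structure_exponential], where A = A] maps_to_refl
  by blast

section \<open>Primitive positive formulas\<close>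

lemma mult_add_less: "v < k \<Longrightarrow> p < n \<Longrightarrow> v * n + p < k * n" for k n p v :: nat
  using mult_le_mono1[of "Suc v" k n] by simp

lemma length_concat_uniform:
  "\<forall>v\<in>set vs. length v = d \<Longrightarrow> length (concat vs) = length vs * d"
  by (induction vs) auto

text \<open>In a pp-power of dimension \<open>d\<close>, coordinate \<open>c\<close> of the
  \<open>q\<close>-th argument is the variable \<open>q * d + c\<close>.\<close>

lemma nth_concat_uniform:
  "\<forall>v\<in>set vs. length v = d \<Longrightarrow> q < length vs \<Longrightarrow> c < d \<Longrightarrow> concat vs ! (q * d + c) = vs ! q ! c"
proof (induction vs arbitrary: q)
  case (Cons v vs)
  then show ?case by (cases q) (auto simp: nth_append)
qed simp

lemma univ_pp_power: "univ (pp_power \<sigma> d \<Delta> A) = {v. length v = d \<and> set v \<subseteq> univ A}"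
  by (simp add: pp_power_def Let_def)

lemma rel_pp_power:
  "rel (pp_power \<sigma> d \<Delta> A) i =
     {vs. length vs = \<sigma> ! i \<and> (\<forall>v\<in>set vs. length v = d \<and> set v \<subseteq> univ A) \<and>
          sat_pp A (concat vs) (\<Delta> ! i)}"
  by (auto simp: pp_power_def Let_def)

section \<open>Preservation of pp-formulas by homomorphisms, products and the loop\<close>

lemma sat_atom_hom:
  assumes h: "is_hom \<tau> A A' h" and "wf_atom \<tau> (length xs) \<phi>" and "sat_atom A xs \<phi>"
  shows "sat_atom A' (map h xs) \<phi>"
proof (cases \<phi>)
  case (RelAtom i vs)
  have "map h (map (\<lambda>v. xs ! v) vs) \<in> rel A' i"
    using assms RelAtom by (intro is_hom_rel[OF h]) auto
  moreover have "map (\<lambda>v. map h xs ! v) vs = map h (map (\<lambda>v. xs ! v) vs)"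
    using assms RelAtom by simp
  ultimately show ?thesis unfolding RelAtom sat_atom.simps by (simp only:)
qed (use assms in auto)

text \<open>Witnesses are mapped along \<open>h\<close>. Well-formedness keeps all indices in range,
  so that \<open>map h\<close> commutes with lookup.\<close>

lemma sat_pp_hom:
  assumes h: "is_hom \<tau> A A' h" and wf: "wf_pp \<tau> (length xs) \<phi>" and sat: "sat_pp A xs \<phi>"
  shows "sat_pp A' (map h xs) \<phi>"
proof -
  obtain m \<phi>s where \<phi>: "\<phi> = PP m \<phi>s" by (cases \<phi>)
  from sat \<phi> obtain ys where ys: "length ys = m" "set ys \<subseteq> univ A"
    "\<forall>\<phi>\<in>set \<phi>s. sat_atom A (xs @ ys) \<phi>" by auto
  have "\<forall>\<phi>\<in>set \<phi>s. sat_atom A' (map h (xs @ ys)) \<phi>"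
    using sat_atom_hom[OF h, of "xs @ ys"] wf ys \<phi> by simp
  with ys is_hom_univ[OF h] show ?thesis
    unfolding \<phi> sat_pp.simps by (intro exI[of _ "map h ys"]) auto
qed

text \<open>Witnesses in the two factors are zipped, since atoms of a product hold
  coordinatewise.\<close>

lemma sat_pp_product:
  assumes len: "length xs = length ys" and wf: "wf_pp \<tau> (length xs) \<phi>"
    and A: "sat_pp A xs \<phi>" and B: "sat_pp B ys \<phi>"
  shows "sat_pp (struct_product A B) (zip xs ys) \<phi>"
proof -
  obtain m \<phi>s where \<phi>: "\<phi> = PP m \<phi>s" by (cases \<phi>)
  from A \<phi> obtain us where us: "length us = m" "set us \<subseteq> univ A"
    "\<forall>\<phi>\<in>set \<phi>s. sat_atom A (xs @ us) \<phi>" by auto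
  from B \<phi> obtain vs where vs: "length vs = m" "set vs \<subseteq> univ B"
    "\<forall>\<phi>\<in>set \<phi>s. sat_atom B (ys @ vs) \<phi>" by auto
  have "sat_atom (struct_product A B) (zip (xs @ us) (ys @ vs)) \<psi>" if "\<psi> \<in> set \<phi>s" for \<psi>
  proof (cases \<psi>)
    case (RelAtom i ws)
    have ws: "\<forall>w\<in>set ws. w < length (xs @ us) \<and> w < length (ys @ vs)"
      using that wf us vs \<phi> RelAtom len by fastforce
    then have "map fst (map (\<lambda>w. zip (xs @ us) (ys @ vs) ! w) ws) = map (\<lambda>w. (xs @ us) ! w) ws"
      and "map snd (map (\<lambda>w. zip (xs @ us) (ys @ vs) ! w) ws) = map (\<lambda>w. (ys @ vs) ! w) ws"
      by (simp_all del: zip_append)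
    moreover have "map (\<lambda>w. (xs @ us) ! w) ws \<in> rel A i" "map (\<lambda>w. (ys @ vs) ! w) ws \<in> rel B i"
      using that us(3) vs(3) RelAtom by fastforce+
    ultimately show ?thesis unfolding RelAtom by (simp add: struct_product_def del: zip_append map_map)
  next
    case (EqAtom u v)
    then have "u < length (xs @ us)" "v < length (xs @ us)" "(xs @ us) ! u = (xs @ us) ! v"
      "(ys @ vs) ! u = (ys @ vs) ! v"
      using that wf us vs \<phi> by fastforce+
    with EqAtom len us(1) vs(1) show ?thesis by (simp del: zip_append)
  qed
  moreover have "set (zip us vs) \<subseteq> univ (struct_product A B)"
    using us(2) vs(2) by (auto simp: struct_product_def dest: set_zip_leftD set_zip_rightD)
  ultimately show ?thesis
    unfolding \<phi> sat_pp.simps using us(1) vs(1) len by (intro exI[of _ "zip us vs"]) simp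
qed

lemma pp_power_mono:
  assumes \<Delta>: "is_pp_definition \<sigma> \<tau> d \<Delta>" and "maps_to \<tau> A A'"
  shows "maps_to \<sigma> (pp_power \<sigma> d \<Delta> A) (pp_power \<sigma> d \<Delta> A')"
proof -
  from assms obtain h where h: "is_hom \<tau> A A' h" unfolding maps_to_def by blast
  have "is_hom \<sigma> (pp_power \<sigma> d \<Delta> A) (pp_power \<sigma> d \<Delta> A') (map h)"
    unfolding is_hom_def
  proof (intro conjI allI impI ballI)
    show "map h ` univ (pp_power \<sigma> d \<Delta> A) \<subseteq> univ (pp_power \<sigma> d \<Delta> A')"
      using is_hom_univ[OF h] by (fastforce simp: univ_pp_power)
    fix i t assume i: "i < length \<sigma>" and t: "t \<in> rel (pp_power \<sigma> d \<Delta> A) i"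
    then have t': "length t = \<sigma> ! i" "\<forall>v\<in>set t. length v = d \<and> set v \<subseteq> univ A"
      "sat_pp A (concat t) (\<Delta> ! i)"
      by (auto simp: univ_pp_power rel_pp_power)
    then have "wf_pp \<tau> (length (concat t)) (\<Delta> ! i)"
      using \<Delta> i length_concat_uniform[of t d] by (simp add: is_pp_definition_def)
    from sat_pp_hom[OF h this t'(3)] have "sat_pp A' (concat (map (map h) t)) (\<Delta> ! i)"
      by (simp add: map_concat)
    then show "map (map h) t \<in> rel (pp_power \<sigma> d \<Delta> A') i"
      using t' is_hom_univ[OF h] by (fastforce simp: univ_pp_power rel_pp_power)
  qed
  then show ?thesis unfolding maps_to_def by blast
qed

text \<open>Vectors are zipped coordinate by coordinate. Followed by evaluation, this lets a power
  of \<open>B\<close> supply the arguments for a power of an exponential.\<close>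

lemma pp_power_product:
  assumes \<Delta>: "is_pp_definition \<sigma> \<tau> d \<Delta>"
  shows "maps_to \<sigma> (struct_product (pp_power \<sigma> d \<Delta> A) (pp_power \<sigma> d \<Delta> B))
           (pp_power \<sigma> d \<Delta> (struct_product A B))"
proof -
  let ?h = "\<lambda>(u, v). zip u v"
  have h: "length (?h x) = d \<and> set (?h x) \<subseteq> univ (struct_product A B)"
    if "length (fst x) = d" "length (snd x) = d" "set (fst x) \<subseteq> univ A" "set (snd x) \<subseteq> univ B" for x
    using that by (cases x) (auto simp: struct_product_def dest: set_zip_leftD set_zip_rightD)
  have "is_hom \<sigma> (struct_product (pp_power \<sigma> d \<Delta> A) (pp_power \<sigma> d \<Delta> B))
      (pp_power \<sigma> d \<Delta> (struct_product A B)) ?h"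
    unfolding is_hom_def
  proof (intro conjI allI impI ballI)
    show "?h ` univ (struct_product (pp_power \<sigma> d \<Delta> A) (pp_power \<sigma> d \<Delta> B))
        \<subseteq> univ (pp_power \<sigma> d \<Delta> (struct_product A B))"
    proof
      fix z assume "z \<in> ?h ` univ (struct_product (pp_power \<sigma> d \<Delta> A) (pp_power \<sigma> d \<Delta> B))"
      then obtain x where "z = ?h x" "length (fst x) = d" "length (snd x) = d"
        "set (fst x) \<subseteq> univ A" "set (snd x) \<subseteq> univ B"
        by (auto simp: struct_product_def univ_pp_power rel_pp_power)
      then show "z \<in> univ (pp_power \<sigma> d \<Delta> (struct_product A B))"
        using h[of x] by (simp add: univ_pp_power rel_pp_power)
    qed
    fix i t assume i: "i < length \<sigma>"
      and "t \<in> rel (struct_product (pp_power \<sigma> d \<Delta> A) (pp_power \<sigma> d \<Delta> B)) i"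
    then have t: "length t = \<sigma> ! i" "\<forall>x\<in>set t. length (fst x) = d \<and> length (snd x) = d \<and>
        set (fst x) \<subseteq> univ A \<and> set (snd x) \<subseteq> univ B"
      "sat_pp A (concat (map fst t)) (\<Delta> ! i)" "sat_pp B (concat (map snd t)) (\<Delta> ! i)"
      by (auto simp: struct_product_def univ_pp_power rel_pp_power)
    have len: "length (concat (map fst t)) = \<sigma> ! i * d" "length (concat (map snd t)) = \<sigma> ! i * d"
      using length_concat_uniform[of "map fst t" d] length_concat_uniform[of "map snd t" d] t
      by simp_all
    have "concat (map ?h t) = zip (concat (map fst t)) (concat (map snd t))"
      using t(2) by (induction t) auto
    moreover have "sat_pp (struct_product A B) \<dots> (\<Delta> ! i)"
      using \<Delta> i len t by (intro sat_pp_product) (auto simp: is_pp_definition_def)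
    ultimately show "map ?h t \<in> rel (pp_power \<sigma> d \<Delta> (struct_product A B)) i"
      using t h by (auto simp: univ_pp_power rel_pp_power)
  qed
  then show ?thesis unfolding maps_to_def by blast
qed

text \<open>All atoms hold in the loop, so every well-formed pp-formula does, with \<open>()\<close>
  for each witness.\<close>

lemma pp_power_loop:
  assumes \<Delta>: "is_pp_definition \<sigma> \<tau> d \<Delta>"
  shows "maps_to \<sigma> (loop \<sigma>) (pp_power \<sigma> d \<Delta> (loop \<tau>))"
proof -
  have sat: "sat_pp (loop \<tau>) xs \<phi>" if "wf_pp \<tau> (length xs) \<phi>" for xs \<phi>
  proof -
    obtain m \<phi>s where \<phi>: "\<phi> = PP m \<phi>s" by (cases \<phi>)
    have "sat_atom (loop \<tau>) (xs @ replicate m ()) \<psi>" if "\<psi> \<in> set \<phi>s" for \<psi>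
    proof (cases \<psi>)
      case (RelAtom i vs)
      then have "length vs = \<tau> ! i" using \<open>wf_pp \<tau> (length xs) \<phi>\<close> \<phi> that by fastforce
      then show ?thesis using RelAtom by (auto simp: loop_def intro!: nth_equalityI)
    qed simp
    then show ?thesis
      unfolding \<phi> sat_pp.simps by (intro exI[of _ "replicate m ()"]) (auto simp: loop_def)
  qed
  have "is_hom \<sigma> (loop \<sigma>) (pp_power \<sigma> d \<Delta> (loop \<tau>)) (\<lambda>_. replicate d ())"
    unfolding is_hom_def
  proof (intro conjI allI impI ballI)
    fix i t assume i: "i < length \<sigma>" and "t \<in> rel (loop \<sigma>) i"
    then have "length t = \<sigma> ! i" by (simp add: loop_def)
    moreover from this have "sat_pp (loop \<tau>) (concat (map (\<lambda>_. replicate d ()) t)) (\<Delta> ! i)"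
      using \<Delta> i length_concat_uniform[of "map (\<lambda>_. replicate d ()) t" d]
      by (intro sat) (simp add: is_pp_definition_def)
    ultimately show "map (\<lambda>_. replicate d ()) t \<in> rel (pp_power \<sigma> d \<Delta> (loop \<tau>)) i"
      by (auto simp: univ_pp_power rel_pp_power loop_def)
  qed (auto simp: univ_pp_power rel_pp_power loop_def)
  then show ?thesis unfolding maps_to_def by blast
qed

section \<open>Substitution and conjunction of pp-formulas\<close>

fun rename_atom :: "(nat \<Rightarrow> nat) \<Rightarrow> pp_atom \<Rightarrow> pp_atom" where
  "rename_atom f (RelAtom i vs) = RelAtom i (map f vs)"
| "rename_atom f (EqAtom u v) = EqAtom (f u) (f v)"

lemma wf_rename_atom:
  "wf_atom \<tau> k \<phi> \<Longrightarrow> (\<And>v. v < k \<Longrightarrow> f v < k') \<Longrightarrow> wf_atom \<tau> k' (rename_atom f \<phi>)"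
  by (cases \<phi>) auto

lemma sat_rename_atom:
  assumes "wf_atom \<tau> k \<phi>" and "\<And>v. v < k \<Longrightarrow> xs ! f v = ys ! v"
  shows "sat_atom A xs (rename_atom f \<phi>) \<longleftrightarrow> sat_atom A ys \<phi>"
proof (cases \<phi>)
  case (RelAtom i vs)
  then have "map (\<lambda>v. xs ! v) (map f vs) = map (\<lambda>v. ys ! v) vs" using assms by simp
  then show ?thesis unfolding RelAtom by (simp only: rename_atom.simps sat_atom.simps)
qed (use assms in simp)

lemma sat_atom_cong:
  assumes "wf_atom \<tau> k \<phi>" and "\<And>v. v < k \<Longrightarrow> xs ! v = ys ! v"
  shows "sat_atom A xs \<phi> \<longleftrightarrow> sat_atom A ys \<phi>"
proof -
  have "rename_atom id \<phi> = \<phi>" by (cases \<phi>) simp_all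
  with sat_rename_atom[OF assms(1), of xs id ys A] assms(2) show ?thesis by simp
qed

text \<open>Quantified variables follow the free ones, so they move when the number of free variables
  changes from \<open>k\<close> to \<open>n\<close>.\<close>

fun pp_subst :: "nat \<Rightarrow> nat \<Rightarrow> (nat \<Rightarrow> nat) \<Rightarrow> pp_formula \<Rightarrow> pp_formula" where
  "pp_subst k n f (PP m \<phi>s) =
     PP m (map (rename_atom (\<lambda>v. if v < k then f v else v - k + n)) \<phi>s)"

lemma wf_pp_subst:
  assumes "wf_pp \<tau> k \<phi>" and f: "\<And>v. v < k \<Longrightarrow> f v < n"
  shows "wf_pp \<tau> n (pp_subst k n f \<phi>)"
proof (cases \<phi>)
  case (PP m \<phi>s)
  have "(if v < k then f v else v - k + n) < n + m" if "v < k + m" for v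
    using f[of v] that by auto
  with assms PP show ?thesis by (auto intro!: wf_rename_atom)
qed

lemma sat_pp_subst:
  assumes wf: "wf_pp \<tau> k \<phi>" and len: "length xs = n" "length zs = k"
    and f: "\<And>v. v < k \<Longrightarrow> f v < n \<and> xs ! f v = zs ! v"
  shows "sat_pp A xs (pp_subst k n f \<phi>) \<longleftrightarrow> sat_pp A zs \<phi>"
proof (cases \<phi>)
  case (PP m \<phi>s)
  have "sat_atom A (xs @ ys) (rename_atom (\<lambda>v. if v < k then f v else v - k + n) \<psi>) \<longleftrightarrow>
      sat_atom A (zs @ ys) \<psi>" if "\<psi> \<in> set \<phi>s" for ys \<psi>
    by (rule sat_rename_atom[of \<tau> "k + m"]) (use that wf PP len f in \<open>auto simp: nth_append\<close>)
  then show ?thesis by (simp add: PP)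
qed

text \<open>The quantified variables of the second formula are shifted past the \<open>m\<close> of
  the first, so the two lists of witnesses are independent and can be appended.\<close>

fun pp_conj :: "nat \<Rightarrow> pp_formula \<Rightarrow> pp_formula \<Rightarrow> pp_formula" where
  "pp_conj n (PP m \<phi>s) (PP m' \<psi>s) =
     PP (m + m') (\<phi>s @ map (rename_atom (\<lambda>v. if v < n then v else v + m)) \<psi>s)"

lemma wf_pp_conj:
  assumes "wf_pp \<tau> n \<phi>" and "wf_pp \<tau> n \<psi>"
  shows "wf_pp \<tau> n (pp_conj n \<phi> \<psi>)"
proof (cases \<phi>; cases \<psi>)
  fix m \<phi>s m' \<psi>s assume [simp]: "\<phi> = PP m \<phi>s" "\<psi> = PP m' \<psi>s"
  have "wf_atom \<tau> (n + (m + m')) \<chi>" if "\<chi> \<in> set \<phi>s" for \<chi>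
    using assms(1) that by (cases \<chi>) fastforce+
  moreover have "wf_atom \<tau> (n + (m + m')) (rename_atom (\<lambda>v. if v < n then v else v + m) \<chi>)"
    if "\<chi> \<in> set \<psi>s" for \<chi>
    using assms(2) that by (intro wf_rename_atom[of \<tau> "n + m'"]) auto
  ultimately show ?thesis by auto
qed

lemma sat_pp_conj:
  assumes wf: "wf_pp \<tau> n \<phi>" "wf_pp \<tau> n \<psi>" and len: "length xs = n"
  shows "sat_pp A xs (pp_conj n \<phi> \<psi>) \<longleftrightarrow> sat_pp A xs \<phi> \<and> sat_pp A xs \<psi>"
proof (cases \<phi>; cases \<psi>)
  fix m \<phi>s m' \<psi>s assume [simp]: "\<phi> = PP m \<phi>s" "\<psi> = PP m' \<psi>s"
  have \<phi>: "sat_atom A (xs @ us @ vs) \<chi> \<longleftrightarrow> sat_atom A (xs @ us) \<chi>"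
    if "\<chi> \<in> set \<phi>s" "length us = m" for \<chi> us vs
    by (rule sat_atom_cong[of \<tau> "n + m"]) (use that wf(1) len in \<open>auto simp: nth_append\<close>)
  have \<psi>: "sat_atom A (xs @ us @ vs) (rename_atom (\<lambda>v. if v < n then v else v + m) \<chi>) \<longleftrightarrow>
      sat_atom A (xs @ vs) \<chi>" if "\<chi> \<in> set \<psi>s" "length us = m" for \<chi> us vs
    by (rule sat_rename_atom[of \<tau> "n + m'"]) (use that wf(2) len in \<open>auto simp: nth_append\<close>)
  show ?thesis
  proof
    assume "sat_pp A xs (pp_conj n \<phi> \<psi>)"
    then obtain ys where "length ys = m + m'" "set ys \<subseteq> univ A"
      "\<forall>\<chi>\<in>set \<phi>s. sat_atom A (xs @ ys) \<chi>"
      "\<forall>\<chi>\<in>set \<psi>s. sat_atom A (xs @ ys) (rename_atom (\<lambda>v. if v < n then v else v + m) \<chi>)"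
      by auto
    moreover obtain us vs where "ys = us @ vs" "length us = m" "length vs = m'"
      using \<open>length ys = m + m'\<close>
      by (metis add_diff_cancel_left' append_take_drop_id length_append length_drop length_take
          min.absorb2 le_add1)
    ultimately show "sat_pp A xs \<phi> \<and> sat_pp A xs \<psi>"
      using \<phi>[of _ us vs] \<psi>[of _ us vs] by auto
  next
    assume "sat_pp A xs \<phi> \<and> sat_pp A xs \<psi>"
    then obtain us vs where "length us = m" "set us \<subseteq> univ A" "length vs = m'" "set vs \<subseteq> univ A"
      "\<forall>\<chi>\<in>set \<phi>s. sat_atom A (xs @ us) \<chi>" "\<forall>\<chi>\<in>set \<psi>s. sat_atom A (xs @ vs) \<chi>"
      by auto
    then show "sat_pp A xs (pp_conj n \<phi> \<psi>)"
      using \<phi>[of _ us vs] \<psi>[of _ us vs] by (auto intro!: exI[of _ "us @ vs"])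
  qed
qed

text \<open>\<open>PP 0 []\<close> is the true formula; it is the whole conjunction when a relation
  of the exponent is empty.\<close>

definition pp_conjs :: "nat \<Rightarrow> pp_formula list \<Rightarrow> pp_formula" where
  "pp_conjs n \<phi>s = foldr (pp_conj n) \<phi>s (PP 0 [])"

lemma wf_pp_conjs: "\<forall>\<phi>\<in>set \<phi>s. wf_pp \<tau> n \<phi> \<Longrightarrow> wf_pp \<tau> n (pp_conjs n \<phi>s)"
  by (induction \<phi>s) (simp_all add: pp_conjs_def wf_pp_conj)

lemma sat_pp_conjs:
  assumes "\<forall>\<phi>\<in>set \<phi>s. wf_pp \<tau> n \<phi>" and "length xs = n"
  shows "sat_pp A xs (pp_conjs n \<phi>s) \<longleftrightarrow> (\<forall>\<phi>\<in>set \<phi>s. sat_pp A xs \<phi>)"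
  using assms(1)
proof (induction \<phi>s)
  case (Cons \<phi> \<phi>s)
  have "pp_conjs n (\<phi> # \<phi>s) = pp_conj n \<phi> (pp_conjs n \<phi>s)" by (simp add: pp_conjs_def)
  moreover have "wf_pp \<tau> n (pp_conjs n \<phi>s)" using Cons.prems by (simp add: wf_pp_conjs)
  ultimately show ?case
    using Cons sat_pp_conj[of \<tau> n \<phi> "pp_conjs n \<phi>s" xs A] assms(2) by simp
qed (simp add: pp_conjs_def)

text \<open>In dimension 1, define each symbol by its own atom; one-entry lists then stand for their
  entries.\<close>

lemma pp_constructs_hom_equivalent:
  assumes A: "is_structure \<tau> A" and "hom_equivalent \<tau> A A'"
  shows "pp_constructs \<tau> A \<tau> A'"
proof -
  define \<Delta> where "\<Delta> = map (\<lambda>i. PP 0 [RelAtom i [0..<\<tau> ! i]]) [0..<length \<tau>]"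
  have sat: "sat_pp A (concat (map (\<lambda>a. [a]) t)) (\<Delta> ! i) \<longleftrightarrow> t \<in> rel A i"
    if "i < length \<tau>" "length t = \<tau> ! i" for i t
    using that by (simp add: \<Delta>_def map_nth flip: that(2))
  have "is_hom \<tau> A (pp_power \<tau> 1 \<Delta> A) (\<lambda>a. [a])"
    unfolding is_hom_def using sat is_structureD[OF A]
    by (fastforce simp: univ_pp_power rel_pp_power)
  moreover have "is_hom \<tau> (pp_power \<tau> 1 \<Delta> A) A hd"
    unfolding is_hom_def
  proof (intro conjI allI impI ballI)
    show "hd ` univ (pp_power \<tau> 1 \<Delta> A) \<subseteq> univ A"
      by (auto simp: univ_pp_power rel_pp_power length_Suc_conv)
    fix i t assume i: "i < length \<tau>" and t: "t \<in> rel (pp_power \<tau> 1 \<Delta> A) i"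
    then have "map (\<lambda>a. [a]) (map hd t) = t"
      by (auto simp: univ_pp_power rel_pp_power length_Suc_conv intro!: map_idI)
    with t sat[OF i, of "map hd t"] show "map hd t \<in> rel A i"
      by (auto simp: univ_pp_power rel_pp_power)
  qed
  ultimately have "hom_equivalent \<tau> (pp_power \<tau> 1 \<Delta> A) A"
    unfolding hom_equivalent_def maps_to_def by blast
  moreover have "is_pp_definition \<tau> \<tau> 1 \<Delta>"
    by (simp add: is_pp_definition_def \<Delta>_def)
  ultimately show ?thesis
    unfolding pp_constructs_def using assms(2) hom_equivalent_trans by blast
qed

text \<open>As \<open>f\<close> also reflects relations and \<open>f (g y) = y\<close>, the section
  \<open>g\<close> preserves them. Comparing relations along a single map thus gives homomorphisms
  both ways; below, \<open>f\<close> always regroups a vector into a table of values.\<close>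

lemma hom_equivalent_section:
  assumes X: "is_structure \<tau> X" and Y: "is_structure \<tau> Y"
    and f: "\<And>x. x \<in> univ X \<Longrightarrow> f x \<in> univ Y"
    and g: "\<And>y. y \<in> univ Y \<Longrightarrow> g y \<in> univ X \<and> f (g y) = y"
    and rel: "\<And>i t. i < length \<tau> \<Longrightarrow> length t = \<tau> ! i \<Longrightarrow> set t \<subseteq> univ X \<Longrightarrow>
       t \<in> rel X i \<longleftrightarrow> map f t \<in> rel Y i"
  shows "hom_equivalent \<tau> X Y"
proof -
  have "is_hom \<tau> X Y f"
    unfolding is_hom_def using f rel is_structureD[OF X] by blast
  moreover have "is_hom \<tau> Y X g"
    unfolding is_hom_def
  proof (intro conjI allI impI ballI)
    fix i t assume i: "i < length \<tau>" and t: "t \<in> rel Y i"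
    have "map f (map g t) = t"
      using is_structureD(2)[OF Y i t] g by (auto intro!: map_idI)
    then show "map g t \<in> rel X i"
      using rel[OF i, of "map g t"] is_structureD[OF Y i t] t g by auto
  qed (use g in blast)
  ultimately show ?thesis unfolding hom_equivalent_def maps_to_def by blast
qed

section \<open>Powers and exponentials with a finite exponent\<close>

locale finite_structure =
  fixes \<tau> :: signature and B :: "'b rel_structure"
  assumes is_structure: "is_structure \<tau> B" and finite_univ: "finite (univ B)"
begin

section \<open>Enumerations of the domain and the relations of the exponent\<close>

abbreviation N :: nat where "N \<equiv> card (univ B)"

definition number :: "'b \<Rightarrow> nat" where
  "number = (SOME f. bij_betw f (univ B) {0..<N})"

definition element :: "nat \<Rightarrow> 'b" where
  "element = inv_into (univ B) number"

text \<open>The order is arbitrary, but repetitions are excluded because encodings of instances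
  forbid them.\<close>

definition tuples :: "nat \<Rightarrow> 'b list list" where
  "tuples i = (SOME ts. set ts = rel B i \<and> distinct ts)"

lemma bij_number: "bij_betw number (univ B) {0..<N}"
  unfolding number_def by (rule someI_ex[OF ex_bij_betw_finite_nat[OF finite_univ]])

lemma number_less: "b \<in> univ B \<Longrightarrow> number b < N"
  using bij_number unfolding bij_betw_def by fastforce

lemma element_number [simp]: "b \<in> univ B \<Longrightarrow> element (number b) = b"
  unfolding element_def using bij_number by (simp add: bij_betw_def)

lemma element_in: "p < N \<Longrightarrow> element p \<in> univ B"
  unfolding element_def using bij_number
  by (metis atLeastLessThan_iff bij_betw_def inv_into_into le0)

lemma number_element [simp]: "p < N \<Longrightarrow> number (element p) = p"
  unfolding element_def using bij_number
  by (metis atLeastLessThan_iff bij_betw_def f_inv_into_f le0)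

lemma tuples:
  assumes "i < length \<tau>"
  shows "set (tuples i) = rel B i \<and> distinct (tuples i)"
proof -
  have "rel B i \<subseteq> {t. set t \<subseteq> univ B \<and> length t = \<tau> ! i}"
    using is_structureD[OF is_structure assms] by blast
  then have "finite (rel B i)"
    using finite_lists_length_eq[OF finite_univ] by (rule finite_subset)
  from someI_ex[OF finite_distinct_list[OF this]] show ?thesis
    unfolding tuples_def .
qed

text \<open>A function from \<open>B\<close> to \<open>d\<close>-vectors is stored as
  \<open>N\<close> blocks of length \<open>d\<close>. The conjunct for a tuple \<open>t\<close> of
  \<open>B\<close> applies \<open>\<Delta> ! i\<close> to block \<open>number (t ! q)\<close> of
  each argument \<open>q\<close>, so the conjunction over all \<open>t\<close> is the relation of
  the exponential.\<close>

definition exponential_power_formula :: "nat \<Rightarrow> pp_formula list \<Rightarrow> nat \<Rightarrow> pp_formula" where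
  "exponential_power_formula d \<Delta> i =
     pp_conjs (\<tau> ! i * (N * d))
       (map (\<lambda>t. pp_subst (\<tau> ! i * d) (\<tau> ! i * (N * d))
               (\<lambda>v. v div d * (N * d) + (number (t ! (v div d)) * d + v mod d)) (\<Delta> ! i))
          (tuples i))"

definition exponential_power :: "nat \<Rightarrow> pp_formula list \<Rightarrow> pp_formula list" where
  "exponential_power d \<Delta> = map (exponential_power_formula d \<Delta>) [0..<length \<tau>]"

lemma exponential_power_variable:
  assumes i: "i < length \<tau>" and t: "t \<in> rel B i" and v: "v < \<tau> ! i * d"
  shows "v div d < \<tau> ! i" and "number (t ! (v div d)) * d + v mod d < N * d"
    and "t ! (v div d) \<in> univ B"
    and "v div d * (N * d) + (number (t ! (v div d)) * d + v mod d) < \<tau> ! i * (N * d)"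
proof -
  \<comment> \<open>In dimension 0 there is no variable \<open>v\<close>, so remainders modulo
    \<open>d\<close> may be taken to be below \<open>d\<close>.\<close>
  have d: "d > 0" using v by (cases d) auto
  show q: "v div d < \<tau> ! i" using v by (simp add: less_mult_imp_div_less)
  then show b: "t ! (v div d) \<in> univ B"
    using is_structureD[OF is_structure i t] by auto
  show p: "number (t ! (v div d)) * d + v mod d < N * d"
    using number_less[OF b] d by (intro mult_add_less) auto
  show "v div d * (N * d) + (number (t ! (v div d)) * d + v mod d) < \<tau> ! i * (N * d)"
    by (rule mult_add_less[OF q p])
qed

lemma is_pp_definition_exponential_power:
  assumes "is_pp_definition \<tau> \<rho> d \<Delta>"
  shows "is_pp_definition \<tau> \<rho> (N * d) (exponential_power d \<Delta>)"
proof -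
  have "wf_pp \<rho> (\<tau> ! i * (N * d)) (exponential_power_formula d \<Delta> i)" if i: "i < length \<tau>" for i
    unfolding exponential_power_formula_def
  proof (rule wf_pp_conjs, clarsimp)
    fix t assume "t \<in> set (tuples i)"
    then have t: "t \<in> rel B i" using tuples[OF i] by blast
    show "wf_pp \<rho> (\<tau> ! i * (N * d)) (pp_subst (\<tau> ! i * d) (\<tau> ! i * (N * d))
        (\<lambda>v. v div d * (N * d) + (number (t ! (v div d)) * d + v mod d)) (\<Delta> ! i))"
      using assms i exponential_power_variable(4)[OF i t]
      by (intro wf_pp_subst) (auto simp: is_pp_definition_def)
  qed
  then show ?thesis
    unfolding is_pp_definition_def exponential_power_def by simp
qed

text \<open>\<open>f\<close> cuts a vector into its \<open>N\<close> blocks, and \<open>g\<close>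
  concatenates the values of a function in the order of \<open>number\<close>. Along
  \<open>f\<close>, each conjunct of the formula becomes the test of the exponential at one tuple of
  \<open>B\<close>.\<close>

lemma pp_power_exponential_power:
  assumes \<Delta>: "is_pp_definition \<tau> \<rho> d \<Delta>"
  shows "hom_equivalent \<tau> (pp_power \<tau> (N * d) (exponential_power d \<Delta>) A)
           (exponential \<tau> (pp_power \<tau> d \<Delta> A) B)"
proof -
  define f where "f u = (\<lambda>b\<in>univ B. take d (drop (number b * d) u))" for u :: "'a list"
  define g where "g h = concat (map (\<lambda>p. h (element p)) [0..<N])" for h :: "'b \<Rightarrow> 'a list"
  have f_length: "length (f u b) = d" if "b \<in> univ B" "length u = N * d" for u b
  proof -
    have "number b * d + d \<le> N * d"
      using mult_le_mono1[of "Suc (number b)" N d] number_less[OF that(1)] by simp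
    then show ?thesis using that by (simp add: f_def)
  qed
  have f_nth: "f u b ! c = u ! (number b * d + c)" if "b \<in> univ B" "length u = N * d" "c < d" for u b c
    using that number_less[OF that(1)] mult_le_mono1[of "Suc (number b)" N d] by (simp add: f_def)
  have f_set: "set (f u b) \<subseteq> set u" if "b \<in> univ B" for u b
    using that by (auto simp: f_def dest!: in_set_takeD in_set_dropD)
  show ?thesis
  proof (rule hom_equivalent_section[where f = f and g = g])
    fix u assume "u \<in> univ (pp_power \<tau> (N * d) (exponential_power d \<Delta>) A)"
    then have u: "length u = N * d" "set u \<subseteq> univ A" by (auto simp: univ_pp_power rel_pp_power)
    have "f u \<in> extensional (univ B)" by (simp add: f_def)
    moreover have "length (f u b) = d \<and> set (f u b) \<subseteq> univ A" if "b \<in> univ B" for b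
      using f_length[OF that u(1)] f_set[OF that] u(2) by blast
    ultimately show "f u \<in> univ (exponential \<tau> (pp_power \<tau> d \<Delta> A) B)"
      by (simp add: exponential_def univ_pp_power rel_pp_power PiE_def Pi_def)
  next
    fix h assume "h \<in> univ (exponential \<tau> (pp_power \<tau> d \<Delta> A) B)"
    then have h: "h \<in> extensional (univ B)"
      "\<And>b. b \<in> univ B \<Longrightarrow> length (h b) = d \<and> set (h b) \<subseteq> univ A"
      by (auto simp: exponential_def univ_pp_power rel_pp_power PiE_def Pi_def)
    have uniform: "\<forall>v\<in>set (map (\<lambda>p. h (element p)) [0..<N]). length v = d"
      using h(2) element_in by auto
    have len: "length (g h) = N * d"
      using length_concat_uniform[OF uniform] by (simp add: g_def)
    have "set (g h) \<subseteq> univ A"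
      using h(2) element_in by (fastforce simp: g_def)
    moreover have "f (g h) = h"
    proof (rule extensionalityI[of _ "univ B"])
      fix b assume b: "b \<in> univ B"
      show "f (g h) b = h b"
      proof (rule nth_equalityI)
        show "length (f (g h) b) = length (h b)" using f_length[OF b len] h(2)[OF b] by simp
        fix c assume "c < length (f (g h) b)"
        then have c: "c < d" using f_length[OF b len] by simp
        have "f (g h) b ! c = g h ! (number b * d + c)" by (rule f_nth[OF b len c])
        also have "\<dots> = h b ! c"
          unfolding g_def using nth_concat_uniform[OF uniform, of "number b" c] c b number_less[OF b]
          by simp
        finally show "f (g h) b ! c = h b ! c" .
      qed
    qed (simp_all add: f_def h(1))
    ultimately show "g h \<in> univ (pp_power \<tau> (N * d) (exponential_power d \<Delta>) A) \<and> f (g h) = h"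
      using len by (simp add: univ_pp_power rel_pp_power)
  next
    fix i vs assume i: "i < length \<tau>" and vs: "length vs = \<tau> ! i"
      and "set vs \<subseteq> univ (pp_power \<tau> (N * d) (exponential_power d \<Delta>) A)"
    then have vs_set: "\<forall>v\<in>set vs. length v = N * d" "\<forall>v\<in>set vs. set v \<subseteq> univ A"
      by (auto simp: univ_pp_power rel_pp_power)
    have len: "length (concat vs) = \<tau> ! i * (N * d)"
      using length_concat_uniform[OF vs_set(1)] vs by simp
    have wf: "wf_pp \<rho> (\<tau> ! i * d) (\<Delta> ! i)" using \<Delta> i by (simp add: is_pp_definition_def)
    let ?\<phi> = "\<lambda>t. pp_subst (\<tau> ! i * d) (\<tau> ! i * (N * d))
      (\<lambda>v. v div d * (N * d) + (number (t ! (v div d)) * d + v mod d)) (\<Delta> ! i)"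
    \<comment> \<open>For one tuple \<open>t\<close> of \<open>B\<close>, the conjunct evaluated at
      the stored tables is the original formula at the values selected by \<open>t\<close>.\<close>
    have t: "wf_pp \<rho> (\<tau> ! i * (N * d)) (?\<phi> t) \<and> (sat_pp A (concat vs) (?\<phi> t) \<longleftrightarrow>
          sat_pp A (concat (map2 (\<lambda>h b. h b) (map f vs) t)) (\<Delta> ! i)) \<and>
        set (map2 (\<lambda>h b. h b) (map f vs) t) \<subseteq> {v. length v = d \<and> set v \<subseteq> univ A}"
      if t: "t \<in> rel B i" for t
    proof (intro conjI)
      note variable = exponential_power_variable[OF i t]
      have lt: "length t = \<tau> ! i" and bt: "\<And>q. q < \<tau> ! i \<Longrightarrow> t ! q \<in> univ B"
        using is_structureD[OF is_structure i t] by auto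
      let ?us = "map2 (\<lambda>h b. h b) (map f vs) t"
      have us: "length ?us = \<tau> ! i" "\<And>q. q < \<tau> ! i \<Longrightarrow> ?us ! q = f (vs ! q) (t ! q)"
        using vs lt by auto
      have us_nth: "length (?us ! q) = d \<and> set (?us ! q) \<subseteq> univ A" if "q < \<tau> ! i" for q
        using that us(2)[OF that] f_length[OF bt[OF that], of "vs ! q"] f_set[OF bt[OF that], of "vs ! q"]
          vs vs_set nth_mem[of q vs] by fastforce
      then have us_set: "\<forall>u\<in>set ?us. length u = d \<and> set u \<subseteq> univ A"
        using us(1) by (metis in_set_conv_nth)
      then show "set ?us \<subseteq> {v. length v = d \<and> set v \<subseteq> univ A}" by blast
      show "wf_pp \<rho> (\<tau> ! i * (N * d)) (?\<phi> t)"
        by (rule wf_pp_subst[OF wf variable(4)])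
      show "sat_pp A (concat vs) (?\<phi> t) \<longleftrightarrow> sat_pp A (concat ?us) (\<Delta> ! i)"
      proof (rule sat_pp_subst[OF wf len])
        show "length (concat ?us) = \<tau> ! i * d"
          using length_concat_uniform[of ?us d] us_set us(1) by simp
        fix v assume v: "v < \<tau> ! i * d"
        let ?q = "v div d" and ?c = "v mod d"
        have c: "?c < d" using v by (cases d) auto
        have "concat vs ! (?q * (N * d) + (number (t ! ?q) * d + ?c)) =
            vs ! ?q ! (number (t ! ?q) * d + ?c)"
          using nth_concat_uniform[OF vs_set(1)] variable[OF v] vs by simp
        also have "\<dots> = ?us ! ?q ! ?c"
          using us(2) variable[OF v] f_nth[of "t ! ?q" "vs ! ?q"] c vs vs_set(1) by simp
        also have "\<dots> = concat ?us ! (?q * d + ?c)"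
        proof (rule nth_concat_uniform[symmetric])
          show "?q < length ?us" using us(1) variable(1)[OF v] by (simp only:)
        qed (use us_set c in blast)+
        finally show "?q * (N * d) + (number (t ! ?q) * d + ?c) < \<tau> ! i * (N * d) \<and>
            concat vs ! (?q * (N * d) + (number (t ! ?q) * d + ?c)) = concat ?us ! v"
          using variable(4)[OF v] by simp
      qed
    qed
    have "vs \<in> rel (pp_power \<tau> (N * d) (exponential_power d \<Delta>) A) i \<longleftrightarrow>
        sat_pp A (concat vs) (exponential_power d \<Delta> ! i)"
      using vs vs_set by (auto simp: univ_pp_power rel_pp_power)
    also have "\<dots> \<longleftrightarrow> (\<forall>t\<in>rel B i. sat_pp A (concat vs) (?\<phi> t))"
      using i t tuples[OF i] sat_pp_conjs[of "map ?\<phi> (tuples i)" \<rho> "\<tau> ! i * (N * d)" "concat vs" A] len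
      by (simp add: exponential_power_def exponential_power_formula_def)
    also have "\<dots> \<longleftrightarrow> (\<forall>t\<in>rel B i. map2 (\<lambda>h b. h b) (map f vs) t \<in> rel (pp_power \<tau> d \<Delta> A) i)"
      (is "_ \<longleftrightarrow> (\<forall>t\<in>_. ?us t \<in> _)")
    proof (rule ball_cong[OF refl])
      fix s assume s: "s \<in> rel B i"
      have power: "us \<in> rel (pp_power \<tau> d \<Delta> A) i \<longleftrightarrow> sat_pp A (concat us) (\<Delta> ! i)"
        if "length us = \<tau> ! i" "set us \<subseteq> {v. length v = d \<and> set v \<subseteq> univ A}" for us
        using that by (auto simp: rel_pp_power)
      show "sat_pp A (concat vs) (?\<phi> s) \<longleftrightarrow> ?us s \<in> rel (pp_power \<tau> d \<Delta> A) i"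
        using t[OF s] power[of "?us s"] is_structureD(1)[OF is_structure i s] vs by simp
    qed
    also have "\<dots> \<longleftrightarrow> map f vs \<in> rel (exponential \<tau> (pp_power \<tau> d \<Delta> A) B) i"
    proof -
      have "f u \<in> univ B \<rightarrow>\<^sub>E univ (pp_power \<tau> d \<Delta> A)" if "u \<in> set vs" for u
      proof -
        have "f u \<in> extensional (univ B)" by (simp add: f_def)
        moreover have "length (f u b) = d \<and> set (f u b) \<subseteq> univ A" if "b \<in> univ B" for b
          using f_length[OF that, of u] f_set[OF that, of u] vs_set \<open>u \<in> set vs\<close> by blast
        ultimately show ?thesis by (simp add: univ_pp_power rel_pp_power PiE_def Pi_def)
      qed
      then show ?thesis using vs by (auto simp: exponential_def)
    qed
    finally show "vs \<in> rel (pp_power \<tau> (N * d) (exponential_power d \<Delta>) A) i \<longleftrightarrow>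
      map f vs \<in> rel (exponential \<tau> (pp_power \<tau> d \<Delta> A) B) i" .
  qed (rule is_structure_pp_power is_structure_exponential)+
qed

text \<open>The variable \<open>v\<close>, standing for a function, is replaced by the variables
  \<open>v * N, \<dots>, v * N + N - 1\<close> standing for its values.\<close>

fun value_atoms :: "pp_atom \<Rightarrow> pp_atom list" where
  "value_atoms (RelAtom i vs) =
     map (\<lambda>bs. RelAtom i (map2 (\<lambda>v b. v * N + number b) vs bs)) (tuples i)"
| "value_atoms (EqAtom u v) = map (\<lambda>p. EqAtom (u * N + p) (v * N + p)) [0..<N]"

fun value_formula :: "pp_formula \<Rightarrow> pp_formula" where
  "value_formula (PP m \<phi>s) = PP (m * N) (concat (map value_atoms \<phi>s))"

lemma wf_value_atoms:
  assumes "wf_atom \<tau> k \<phi>" and "\<psi> \<in> set (value_atoms \<phi>)"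
  shows "wf_atom \<tau> (k * N) \<psi>"
proof (cases \<phi>)
  case (RelAtom i vs)
  then obtain bs where bs: "bs \<in> set (tuples i)" and
    \<psi>: "\<psi> = RelAtom i (map2 (\<lambda>v b. v * N + number b) vs bs)" using assms by auto
  have i: "i < length \<tau>" using assms RelAtom by simp
  have "length bs = \<tau> ! i" "set bs \<subseteq> univ B"
    using is_structureD[OF is_structure i] tuples[OF i] bs by blast+
  with assms RelAtom show ?thesis
    unfolding \<psi> by (auto intro!: mult_add_less number_less dest: set_zip_leftD set_zip_rightD)
qed (use assms in \<open>auto intro!: mult_add_less\<close>)

lemma wf_value_formula:
  assumes "wf_pp \<tau> n \<phi>"
  shows "wf_pp \<tau> (n * N) (value_formula \<phi>)"
proof (cases \<phi>)
  case (PP m \<phi>s)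
  with assms wf_value_atoms[of "n + m"] show ?thesis by (auto simp: add_mult_distrib)
qed

text \<open>The number \<open>k\<close> of blocks is an argument because the length of
  \<open>xs\<close> does not determine it when \<open>N = 0\<close>.\<close>

definition blocks :: "nat \<Rightarrow> 'x list \<Rightarrow> ('b \<Rightarrow> 'x) list" where
  "blocks k xs = map (\<lambda>q. \<lambda>b\<in>univ B. xs ! (q * N + number b)) [0..<k]"

lemma length_blocks [simp]: "length (blocks k xs) = k"
  by (simp add: blocks_def)

lemma blocks_nth: "q < k \<Longrightarrow> b \<in> univ B \<Longrightarrow> (blocks k xs ! q) b = xs ! (q * N + number b)"
  by (simp add: blocks_def)

lemma blocks_set:
  assumes "length xs = k * N" and "set xs \<subseteq> A"
  shows "set (blocks k xs) \<subseteq> univ B \<rightarrow>\<^sub>E A"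
proof -
  have "xs ! (q * N + number b) \<in> A" if "q < k" "b \<in> univ B" for q b
    using assms mult_add_less[OF that(1) number_less[OF that(2)]] nth_mem by fastforce
  then show ?thesis by (auto simp: blocks_def)
qed

lemma blocks_append:
  assumes xs: "length xs = k * N"
  shows "blocks (k + m) (xs @ ys) = blocks k xs @ blocks m ys"
proof (rule nth_equalityI)
  fix q assume "q < length (blocks (k + m) (xs @ ys))"
  then have q: "q < k + m" by simp
  show "blocks (k + m) (xs @ ys) ! q = (blocks k xs @ blocks m ys) ! q"
  proof (cases "q < k")
    case True
    then have "q * N + number b < k * N" if "b \<in> univ B" for b
      using mult_add_less number_less that by blast
    with True xs show ?thesis by (auto simp: blocks_def nth_append restrict_def)
  next
    case False
    then obtain q' where "q = k + q'" using le_Suc_ex not_less by blast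
    with q xs show ?thesis
      by (auto simp: blocks_def nth_append restrict_def add_mult_distrib)
  qed
qed simp

lemma blocks_concat:
  "\<forall>v\<in>set vs. length v = d * N \<Longrightarrow>
    blocks (length vs * d) (concat vs) = concat (map (blocks d) vs)"
proof (induction vs)
  case (Cons v vs)
  then show ?case using blocks_append[of v d "length vs * d" "concat vs"] by simp
qed (simp add: blocks_def)

text \<open>Each function is tabulated in the order of \<open>number\<close>. This supplies the
  values that witness a quantified function.\<close>

lemma blocks_surj:
  assumes "set fs \<subseteq> univ B \<rightarrow>\<^sub>E A"
  shows "\<exists>xs. length xs = length fs * N \<and> set xs \<subseteq> A \<and> blocks (length fs) xs = fs"
  using assms
proof (induction fs)
  case (Cons f fs)
  then obtain xs where xs: "length xs = length fs * N" "set xs \<subseteq> A"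
    "blocks (length fs) xs = fs" by auto
  let ?y = "map (\<lambda>p. f (element p)) [0..<N]"
  have "blocks 1 ?y = [f]"
    using Cons.prems number_less by (auto simp: blocks_def fun_eq_iff PiE_def extensional_def)
  then have "blocks (length (f # fs)) (?y @ xs) = f # fs"
    using blocks_append[of ?y 1 "length fs" xs] xs by simp
  moreover have "set (?y @ xs) \<subseteq> A"
    using xs Cons.prems element_in by (fastforce simp: PiE_def Pi_def)
  ultimately show ?case using xs(1) by (intro exI[of _ "?y @ xs"]) simp
qed (simp add: blocks_def)

text \<open>A relational atom of the exponential is a conjunction over the tuples of
  \<open>B\<close>, and an equality of extensional functions is a conjunction over the elements of
  \<open>B\<close>.\<close>

lemma sat_value_atoms:
  assumes wf: "wf_atom \<tau> k \<phi>" and len: "length xs = k * N" and xs: "set xs \<subseteq> univ A"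
  shows "(\<forall>\<psi>\<in>set (value_atoms \<phi>). sat_atom A xs \<psi>) \<longleftrightarrow>
         sat_atom (exponential \<tau> A B) (blocks k xs) \<phi>"
proof (cases \<phi>)
  case (RelAtom i vs)
  have i: "i < length \<tau>" "length vs = \<tau> ! i" "\<forall>v\<in>set vs. v < k" using wf RelAtom by auto
  have "map (\<lambda>v. xs ! v) (map2 (\<lambda>v b. v * N + number b) vs bs) =
      map2 (\<lambda>f b. f b) (map (\<lambda>v. blocks k xs ! v) vs) bs" if "bs \<in> rel B i" for bs
    using i is_structureD[OF is_structure i(1) that]
    by (intro nth_equalityI) (simp_all add: blocks_nth subset_iff)
  moreover have "blocks k xs ! v \<in> univ B \<rightarrow>\<^sub>E univ A" if "v \<in> set vs" for v
    using blocks_set[OF len xs] i(3) that by (metis length_blocks nth_mem subsetD)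
  ultimately show ?thesis
    using RelAtom tuples[OF i(1)] i(2) by (auto simp: exponential_def)
next
  case (EqAtom u v)
  then have uv: "u < k" "v < k" using wf by auto
  \<comment> \<open>Positions below \<open>N\<close> and elements of \<open>B\<close> correspond
    through \<open>element\<close> and \<open>number\<close>.\<close>
  have "(\<forall>p<N. xs ! (u * N + p) = xs ! (v * N + p)) \<longleftrightarrow>
      (\<forall>b\<in>univ B. xs ! (u * N + number b) = xs ! (v * N + number b))"
    using number_less element_in number_element by metis
  also have "\<dots> \<longleftrightarrow> blocks k xs ! u = blocks k xs ! v"
    using uv by (auto simp: blocks_def restrict_def fun_eq_iff)
  finally show ?thesis using EqAtom by auto
qed

text \<open>Witnesses pass from values to functions by \<open>blocks\<close>, and back by its
  surjectivity.\<close>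

lemma sat_value_formula:
  assumes wf: "wf_pp \<tau> n \<phi>" and len: "length xs = n * N" and xs: "set xs \<subseteq> univ A"
  shows "sat_pp A xs (value_formula \<phi>) \<longleftrightarrow> sat_pp (exponential \<tau> A B) (blocks n xs) \<phi>"
proof -
  obtain m \<phi>s where \<phi>: "\<phi> = PP m \<phi>s" by (cases \<phi>)
  have sat: "(\<forall>\<psi>\<in>set (concat (map value_atoms \<phi>s)). sat_atom A (xs @ ys) \<psi>) \<longleftrightarrow>
      (\<forall>\<psi>\<in>set \<phi>s. sat_atom (exponential \<tau> A B) (blocks n xs @ blocks m ys) \<psi>)"
    if "length ys = m * N" "set ys \<subseteq> univ A" for ys
  proof -
    have "(\<forall>\<chi>\<in>set (value_atoms \<psi>). sat_atom A (xs @ ys) \<chi>) \<longleftrightarrow>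
        sat_atom (exponential \<tau> A B) (blocks n xs @ blocks m ys) \<psi>" if "\<psi> \<in> set \<phi>s" for \<psi>
      using sat_value_atoms[of "n + m" \<psi> "xs @ ys" A] that wf \<phi> len xs
        \<open>length ys = m * N\<close> \<open>set ys \<subseteq> univ A\<close> blocks_append[OF len, of m ys]
      by (simp add: add_mult_distrib)
    then show ?thesis by auto
  qed
  show ?thesis
  proof
    assume "sat_pp A xs (value_formula \<phi>)"
    then obtain ys where ys: "length ys = m * N" "set ys \<subseteq> univ A"
      "\<forall>\<psi>\<in>set (concat (map value_atoms \<phi>s)). sat_atom A (xs @ ys) \<psi>"
      unfolding \<phi> by auto
    then show "sat_pp (exponential \<tau> A B) (blocks n xs) \<phi>"
      using sat[OF ys(1,2)] blocks_set[OF ys(1,2)] unfolding \<phi> sat_pp.simps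
      by (intro exI[of _ "blocks m ys"]) (simp add: exponential_def)
  next
    assume "sat_pp (exponential \<tau> A B) (blocks n xs) \<phi>"
    then obtain fs where fs: "length fs = m" "set fs \<subseteq> univ B \<rightarrow>\<^sub>E univ A"
      "\<forall>\<psi>\<in>set \<phi>s. sat_atom (exponential \<tau> A B) (blocks n xs @ fs) \<psi>"
      unfolding \<phi> by (auto simp: exponential_def)
    then obtain ys where "length ys = m * N" "set ys \<subseteq> univ A" "blocks m ys = fs"
      using blocks_surj[OF fs(2)] by auto
    with sat[of ys] fs(3) show "sat_pp A xs (value_formula \<phi>)"
      unfolding \<phi> value_formula.simps sat_pp.simps by blast
  qed
qed

lemma is_pp_definition_value:
  "is_pp_definition \<sigma> \<tau> d \<Gamma> \<Longrightarrow> is_pp_definition \<sigma> \<tau> (d * N) (map value_formula \<Gamma>)"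
  using wf_value_formula by (auto simp: is_pp_definition_def mult.assoc[symmetric])

lemma pp_power_value:
  assumes \<Gamma>: "is_pp_definition \<sigma> \<tau> d \<Gamma>"
  shows "hom_equivalent \<sigma> (pp_power \<sigma> (d * N) (map value_formula \<Gamma>) A)
           (pp_power \<sigma> d \<Gamma> (exponential \<tau> A B))"
proof -
  obtain g where g: "length (g fs) = length fs * N" "set (g fs) \<subseteq> univ A"
      "blocks (length fs) (g fs) = fs" if "set fs \<subseteq> univ B \<rightarrow>\<^sub>E univ A" for fs
    using blocks_surj[of _ "univ A"] by metis
  show ?thesis
  proof (rule hom_equivalent_section[where f = "blocks d" and g = g])
    fix x assume "x \<in> univ (pp_power \<sigma> (d * N) (map value_formula \<Gamma>) A)"
    then show "blocks d x \<in> univ (pp_power \<sigma> d \<Gamma> (exponential \<tau> A B))"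
      using blocks_set[of x d "univ A"] by (simp add: univ_pp_power rel_pp_power exponential_def)
  next
    fix y assume "y \<in> univ (pp_power \<sigma> d \<Gamma> (exponential \<tau> A B))"
    then show "g y \<in> univ (pp_power \<sigma> (d * N) (map value_formula \<Gamma>) A) \<and> blocks d (g y) = y"
      using g[of y] by (auto simp: univ_pp_power rel_pp_power exponential_def)
  next
    fix i vs assume i: "i < length \<sigma>" "length vs = \<sigma> ! i"
      and "set vs \<subseteq> univ (pp_power \<sigma> (d * N) (map value_formula \<Gamma>) A)"
    then have vs: "\<forall>v\<in>set vs. length v = d * N" "\<forall>v\<in>set vs. set v \<subseteq> univ A"
      by (auto simp: univ_pp_power rel_pp_power)
    have wf: "wf_pp \<tau> (\<sigma> ! i * d) (\<Gamma> ! i)" and "i < length \<Gamma>"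
      using \<Gamma> i by (auto simp: is_pp_definition_def)
    then have "sat_pp A (concat vs) (map value_formula \<Gamma> ! i) \<longleftrightarrow>
        sat_pp (exponential \<tau> A B) (concat (map (blocks d) vs)) (\<Gamma> ! i)"
      using sat_value_formula[OF wf, of "concat vs" A] length_concat_uniform[OF vs(1)] vs i
        blocks_concat[OF vs(1)] by (auto simp: mult.assoc)
    moreover have "set (blocks d v) \<subseteq> univ B \<rightarrow>\<^sub>E univ A" if "v \<in> set vs" for v
      using blocks_set[of v d "univ A"] vs that by blast
    ultimately show "vs \<in> rel (pp_power \<sigma> (d * N) (map value_formula \<Gamma>) A) i \<longleftrightarrow>
        map (blocks d) vs \<in> rel (pp_power \<sigma> d \<Gamma> (exponential \<tau> A B)) i"
      using i vs by (auto simp: univ_pp_power rel_pp_power exponential_def)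
  qed (rule is_structure_pp_power)+
qed

end

text \<open>Forward, the new definition is \<open>exponential_power\<close> with exponent
  \<open>B\<^sub>2\<close>; backward, it is obtained by \<open>value_formula\<close> with exponent
  \<open>B\<^sub>1\<close>.\<close>

theorem rpp_constructs_iff_pp_constructs_exponential:
  assumes A1: "is_structure \<tau>\<^sub>1 A\<^sub>1" and B1: "is_structure \<tau>\<^sub>1 B\<^sub>1" "finite (univ B\<^sub>1)"
    and A2: "is_structure \<tau>\<^sub>2 A\<^sub>2" and B2: "is_structure \<tau>\<^sub>2 B\<^sub>2" "finite (univ B\<^sub>2)"
  shows "rpp_constructs \<tau>\<^sub>1 (A\<^sub>1, B\<^sub>1) \<tau>\<^sub>2 (A\<^sub>2, B\<^sub>2) \<longleftrightarrow>
    pp_constructs \<tau>\<^sub>1 (exponential \<tau>\<^sub>1 A\<^sub>1 B\<^sub>1) \<tau>\<^sub>2 (exponential \<tau>\<^sub>2 A\<^sub>2 B\<^sub>2)"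
proof -
  interpret I1: finite_structure \<tau>\<^sub>1 B\<^sub>1 by unfold_locales (fact B1)+
  interpret I2: finite_structure \<tau>\<^sub>2 B\<^sub>2 by unfold_locales (fact B2)+
  let ?E = "exponential \<tau>\<^sub>1 A\<^sub>1 B\<^sub>1"
  show ?thesis
  proof
    assume "rpp_constructs \<tau>\<^sub>1 (A\<^sub>1, B\<^sub>1) \<tau>\<^sub>2 (A\<^sub>2, B\<^sub>2)"
    then obtain d \<Delta> where \<Delta>: "is_pp_definition \<tau>\<^sub>2 \<tau>\<^sub>1 d \<Delta>"
      and eq: "hom_equivalent \<tau>\<^sub>2 (struct_product (pp_power \<tau>\<^sub>2 d \<Delta> A\<^sub>1) B\<^sub>2) (struct_product A\<^sub>2 B\<^sub>2)"
      and B: "maps_to \<tau>\<^sub>2 B\<^sub>2 (pp_power \<tau>\<^sub>2 d \<Delta> B\<^sub>1)"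
      by auto
    let ?P = "\<lambda>A. pp_power \<tau>\<^sub>2 d \<Delta> A"
    have "maps_to \<tau>\<^sub>2 (?P A\<^sub>1) (?P ?E)"
      by (rule pp_power_mono[OF \<Delta> maps_to_exponential[OF A1 B1(1)]])
    then have 1: "maps_to \<tau>\<^sub>2 (exponential \<tau>\<^sub>2 (?P A\<^sub>1) B\<^sub>2) (exponential \<tau>\<^sub>2 (?P ?E) B\<^sub>2)"
      by (rule exponential_mono[OF B2(1) maps_to_trans[OF product_maps_to_fst]])
    \<comment> \<open>The condition on \<open>B\<^sub>2\<close> turns its elements into vectors over
      \<open>B\<^sub>1\<close>, at which vectors of functions can be evaluated.\<close>
    have "maps_to \<tau>\<^sub>2 (struct_product (?P ?E) B\<^sub>2) (struct_product (?P ?E) (?P B\<^sub>1))"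
      by (rule product_mono[OF maps_to_refl B])
    from maps_to_trans[OF this maps_to_trans[OF pp_power_product[OF \<Delta>]
        pp_power_mono[OF \<Delta> exponential_evaluation[OF B1(1), of A\<^sub>1]]]]
    have "maps_to \<tau>\<^sub>2 (struct_product (?P ?E) B\<^sub>2) (?P A\<^sub>1)" .
    then have 2: "maps_to \<tau>\<^sub>2 (exponential \<tau>\<^sub>2 (?P ?E) B\<^sub>2) (exponential \<tau>\<^sub>2 (?P A\<^sub>1) B\<^sub>2)"
      by (rule exponential_mono[OF B2(1)])
    have "hom_equivalent \<tau>\<^sub>2 (exponential \<tau>\<^sub>2 (?P A\<^sub>1) B\<^sub>2) (exponential \<tau>\<^sub>2 A\<^sub>2 B\<^sub>2)"
      using eq hom_equivalent_product_iff[OF B2(1) is_structure_pp_power A2] by blast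
    moreover have "hom_equivalent \<tau>\<^sub>2 (exponential \<tau>\<^sub>2 (?P ?E) B\<^sub>2) (exponential \<tau>\<^sub>2 (?P A\<^sub>1) B\<^sub>2)"
      using 1 2 unfolding hom_equivalent_def by blast
    ultimately have "hom_equivalent \<tau>\<^sub>2
        (pp_power \<tau>\<^sub>2 (I2.N * d) (I2.exponential_power d \<Delta>) ?E) (exponential \<tau>\<^sub>2 A\<^sub>2 B\<^sub>2)"
      using hom_equivalent_trans[OF I2.pp_power_exponential_power[OF \<Delta>]] hom_equivalent_trans
      by blast
    then show "pp_constructs \<tau>\<^sub>1 ?E \<tau>\<^sub>2 (exponential \<tau>\<^sub>2 A\<^sub>2 B\<^sub>2)"
      unfolding pp_constructs_def
      using I2.is_pp_definition_exponential_power[OF \<Delta>] by blast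
  next
    assume "pp_constructs \<tau>\<^sub>1 ?E \<tau>\<^sub>2 (exponential \<tau>\<^sub>2 A\<^sub>2 B\<^sub>2)"
    then obtain d \<Gamma> where \<Gamma>: "is_pp_definition \<tau>\<^sub>2 \<tau>\<^sub>1 d \<Gamma>"
      and eq: "hom_equivalent \<tau>\<^sub>2 (pp_power \<tau>\<^sub>2 d \<Gamma> ?E) (exponential \<tau>\<^sub>2 A\<^sub>2 B\<^sub>2)"
      unfolding pp_constructs_def by blast
    let ?P = "pp_power \<tau>\<^sub>2 (d * I1.N) (map I1.value_formula \<Gamma>) A\<^sub>1"
    have "hom_equivalent \<tau>\<^sub>2 ?P (exponential \<tau>\<^sub>2 A\<^sub>2 B\<^sub>2)"
      by (rule hom_equivalent_trans[OF I1.pp_power_value[OF \<Gamma>] eq])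
    then have P: "maps_to \<tau>\<^sub>2 ?P (exponential \<tau>\<^sub>2 A\<^sub>2 B\<^sub>2)" "maps_to \<tau>\<^sub>2 (exponential \<tau>\<^sub>2 A\<^sub>2 B\<^sub>2) ?P"
      unfolding hom_equivalent_def by blast+
    have "maps_to \<tau>\<^sub>2 (struct_product ?P B\<^sub>2) A\<^sub>2"
      using P(1) maps_to_exponential_iff[OF is_structure_pp_power B2(1)] by blast
    then have "maps_to \<tau>\<^sub>2 (struct_product ?P B\<^sub>2) (struct_product A\<^sub>2 B\<^sub>2)"
      by (rule maps_to_product[OF _ product_maps_to_snd])
    \<comment> \<open>On the first coordinate, \<open>A\<^sub>2\<close> goes to constant maps and
      then to \<open>?P\<close>.\<close>
    moreover have "maps_to \<tau>\<^sub>2 (struct_product A\<^sub>2 B\<^sub>2) (struct_product ?P B\<^sub>2)"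
      by (rule product_mono[OF maps_to_trans[OF maps_to_exponential[OF A2 B2(1)] P(2)] maps_to_refl])
    moreover have "maps_to \<tau>\<^sub>2 B\<^sub>2 (pp_power \<tau>\<^sub>2 (d * I1.N) (map I1.value_formula \<Gamma>) B\<^sub>1)"
    proof -
      \<comment> \<open>The identity map is a loop of \<open>B\<^sub>1\<^bsup>B\<^sub>1\<^esup>\<close>, and pp-powers preserve loops.\<close>
      have "maps_to \<tau>\<^sub>1 (loop \<tau>\<^sub>1) (exponential \<tau>\<^sub>1 B\<^sub>1 B\<^sub>1)"
        using maps_to_exponential_iff[OF is_structure_loop B1(1)] product_maps_to_snd by blast
      from pp_power_mono[OF \<Gamma> this] pp_power_loop[OF \<Gamma>]
      have "maps_to \<tau>\<^sub>2 (loop \<tau>\<^sub>2) (pp_power \<tau>\<^sub>2 d \<Gamma> (exponential \<tau>\<^sub>1 B\<^sub>1 B\<^sub>1))"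
        using maps_to_trans by blast
      then have "maps_to \<tau>\<^sub>2 B\<^sub>2 (pp_power \<tau>\<^sub>2 d \<Gamma> (exponential \<tau>\<^sub>1 B\<^sub>1 B\<^sub>1))"
        by (rule maps_to_trans[OF maps_to_loop[OF B2(1)]])
      then show ?thesis
        using I1.pp_power_value[OF \<Gamma>, of B\<^sub>1] maps_to_trans unfolding hom_equivalent_def by blast
    qed
    ultimately show "rpp_constructs \<tau>\<^sub>1 (A\<^sub>1, B\<^sub>1) \<tau>\<^sub>2 (A\<^sub>2, B\<^sub>2)"
      unfolding rpp_constructs.simps hom_equivalent_def
      using I1.is_pp_definition_value[OF \<Gamma>] by blast
  qed
qed

section \<open>Two-way finite transducers\<close>

text \<open>One step outputs a word and then either halts (\<open>None\<close>) or changes state and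
  moves the head.\<close>

type_synonym 'q transducer = "'q \<Rightarrow> input_symbol \<Rightarrow> word \<times> ('q \<times> move) option"

text \<open>Being inductive, the relation covers halting runs only. The head is kept between the end
  markers exactly as in \<open>step\<close>.\<close>

inductive transduces :: "'q transducer \<Rightarrow> word \<Rightarrow> 'q \<Rightarrow> nat \<Rightarrow> word \<Rightarrow> bool" for \<delta> w where
  halt: "\<delta> q (read_input w p) = (u, None) \<Longrightarrow> transduces \<delta> w q p u"
| move: "\<delta> q (read_input w p) = (u, Some (q', mv)) \<Longrightarrow>
    transduces \<delta> w q' (min (move_pos mv p) (length w + 1)) v \<Longrightarrow> transduces \<delta> w q p (u @ v)"

text \<open>The type of states may be infinite; finiteness is asked of a set \<open>Q\<close> that
  contains the start and is closed under transitions.\<close>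

locale finite_transducer =
  fixes \<delta> :: "'q transducer" and Q :: "'q set" and q0 :: 'q
  assumes finite_states: "finite Q" and start: "q0 \<in> Q"
    and closed: "\<And>q x u q' mv. q \<in> Q \<Longrightarrow> \<delta> q x = (u, Some (q', mv)) \<Longrightarrow> q' \<in> Q"
begin

text \<open>This bounds the counter of letters already written, which makes the control
  finite.\<close>

definition max_output :: nat where
  "max_output = Max ((\<lambda>(q, x). length (fst (\<delta> q x))) `
      (Q \<times> ({LeftEnd, RightEnd} \<union> Letter ` {One, Comma, Semicolon, Bar})))"

text \<open>In the control state \<open>(q, k)\<close> the first \<open>k\<close> letters of the current output are written.\<close>

definition control :: "('q \<times> nat) set" where "control = Q \<times> {..max_output}"

definition code :: "'q \<times> nat \<Rightarrow> nat" where
  "code = (SOME f. bij_betw f control {0..<card control})"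

text \<open>A machine appends at most one letter per step, so an output word is spelled out while
  the heads stay. Halting becomes the query, and the answer states are the halting states
  themselves. The work head never moves.\<close>

definition query_machine :: machine where
  "query_machine =
    (let S = card control in
     \<lparr>num_states = S + 3, num_symbols = 1, start_state = code (q0, 0), accept_state = S,
      reject_state = S + 1, query_state = S + 2, yes_state = S, no_state = S + 1,
      trans = (\<lambda>s x _.
        if s < S then
          (case inv_into control code s of (q, k) \<Rightarrow> case \<delta> q x of (u, next) \<Rightarrow>
             if k < length u then (code (q, Suc k), 0, Stay, Stay, Some (u ! k))
             else (case next of None \<Rightarrow> (S + 2, 0, Stay, Stay, None)
                   | Some (q', mv) \<Rightarrow> (code (q', 0), 0, mv, Stay, None)))
        else (s, 0, Stay, Stay, None))\<rparr>)"

section \<open>Correctness of the machine simulating a transducer\<close>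

lemma length_output: "q \<in> Q \<Longrightarrow> \<delta> q x = (u, r) \<Longrightarrow> length u \<le> max_output"
proof -
  assume q: "q \<in> Q" and \<delta>: "\<delta> q x = (u, r)"
  have "x \<in> {LeftEnd, RightEnd} \<union> Letter ` {One, Comma, Semicolon, Bar}"
  proof (cases x)
    case (Letter l)
    then show ?thesis by (cases l) simp_all
  qed simp_all
  then have "(q, x) \<in> Q \<times> ({LeftEnd, RightEnd} \<union> Letter ` {One, Comma, Semicolon, Bar})"
    using q by blast
  then have "length (fst (\<delta> q x)) \<le> max_output"
    unfolding max_output_def using finite_states by (intro Max_ge) (simp, force)
  with \<delta> show ?thesis by simp
qed

lemma bij_code: "bij_betw code control {0..<card control}"
  unfolding code_def
  by (rule someI_ex[OF ex_bij_betw_finite_nat]) (simp add: control_def finite_states)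

lemma code_less: "c \<in> control \<Longrightarrow> code c < card control"
  using bij_code unfolding bij_betw_def by fastforce

lemma decode: "c \<in> control \<Longrightarrow> inv_into control code (code c) = c"
  using bij_code by (simp add: bij_betw_def)

lemma decode_in: "s < card control \<Longrightarrow> inv_into control code s \<in> control"
  using bij_code unfolding bij_betw_def by (metis atLeastLessThan_iff inv_into_into le0)

lemma is_machine_query_machine: "is_machine query_machine"
proof -
  have trans: "fst (trans query_machine q x s) < card control + 3 \<and>
      fst (snd (trans query_machine q x s)) < 1"
    if "q < card control + 3" for q x s
  proof (cases "q < card control")
    case True
    obtain q1 k where d: "inv_into control code q = (q1, k)" by fastforce
    obtain u r where \<delta>: "\<delta> q1 x = (u, r)" by fastforce
    have q1: "q1 \<in> Q" using decode_in[OF True] d by (simp add: control_def)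
    have "code (q1, Suc k) < card control" if "k < length u"
      using that length_output[OF q1 \<delta>] q1 by (intro code_less) (simp add: control_def)
    moreover have "code (q', 0) < card control" if "r = Some (q', mv)" for q' mv
      using closed[OF q1] \<delta> that by (intro code_less) (simp add: control_def)
    ultimately show ?thesis
      using True d \<delta> by (auto simp: query_machine_def Let_def intro: trans_less_add1 split: option.splits)
  qed (use that in \<open>simp add: query_machine_def Let_def\<close>)
  have "code (q0, 0) < card control"
    by (intro code_less) (simp add: control_def start)
  moreover have "num_states query_machine = card control + 3" "num_symbols query_machine = 1"
    by (simp_all add: query_machine_def Let_def)
  moreover have "case trans query_machine q x s of
      (q', s', _) \<Rightarrow> q' < card control + 3 \<and> s' < 1" if "q < card control + 3" for q x s
    using trans[OF that, of x s] by (cases "trans query_machine q x s") simp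
  ultimately show ?thesis
    unfolding is_machine_def by (simp add: query_machine_def Let_def)
qed

lemma work_pos_query_machine: "work_pos (config_at query_machine X w t) = 0"
proof (induction t)
  case 0
  then show ?case by (simp add: config_at_def initial_def)
next
  case (Suc t)
  have "work_pos (step query_machine X w c) = 0" if "work_pos c = 0" for c
    using that
    by (auto simp: step_def query_machine_def Let_def split: prod.splits option.splits if_splits)
  with Suc show ?case by (simp add: config_at_def)
qed

text \<open>The work tape stays blank with its head at 0, so these three parameters describe every
  configuration of a run from the start to the query.\<close>

definition snapshot :: "nat \<Rightarrow> nat \<Rightarrow> word \<Rightarrow> config" where
  "snapshot s p z = \<lparr>state = s, input_pos = p, work_pos = 0, work_tape = (\<lambda>_. 0), oracle_tape = z\<rparr>"

lemma step_emit:
  assumes "q \<in> Q" and "\<delta> q (read_input w p) = (u, r)" and "p \<le> length w + 1" and "k < length u"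
  shows "step query_machine X w (snapshot (code (q, k)) p z) = snapshot (code (q, Suc k)) p (z @ [u ! k])"
proof -
  have "(q, k) \<in> control" using assms length_output[of q] by (fastforce simp: control_def)
  from code_less[OF this] decode[OF this] show ?thesis
    using assms by (simp add: step_def query_machine_def Let_def snapshot_def fun_upd_idem)
qed

lemma step_move:
  assumes "q \<in> Q" and "\<delta> q (read_input w p) = (u, r)" and "p \<le> length w + 1"
  shows "step query_machine X w (snapshot (code (q, length u)) p z) =
    (case r of None \<Rightarrow> snapshot (query_state query_machine) p z
     | Some (q', mv) \<Rightarrow> snapshot (code (q', 0)) (min (move_pos mv p) (length w + 1)) z)"
proof -
  have "(q, length u) \<in> control" using assms length_output[of q] by (fastforce simp: control_def)
  from code_less[OF this] decode[OF this] show ?thesis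
    using assms
    by (simp add: step_def query_machine_def Let_def snapshot_def fun_upd_idem split: option.splits)
qed

lemma steps_emit:
  assumes "q \<in> Q" and "\<delta> q (read_input w p) = (u, r)" and "p \<le> length w + 1"
  shows "k \<le> length u \<Longrightarrow>
    (step query_machine X w ^^ k) (snapshot (code (q, 0)) p z) = snapshot (code (q, k)) p (z @ take k u)"
proof (induction k)
  case (Suc k)
  then show ?case
    using step_emit[OF assms, of k X "z @ take k u"] by (simp add: take_Suc_conv_app_nth)
qed simp

text \<open>Induction on the run, with the oracle tape content \<open>z\<close> general because
  output accumulates.\<close>

lemma transduces_steps:
  assumes "transduces \<delta> w q p u" and "q \<in> Q" and "p \<le> length w + 1"
  shows "\<exists>t p'. (step query_machine X w ^^ t) (snapshot (code (q, 0)) p z) =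
           snapshot (query_state query_machine) p' (z @ u)"
  using assms
proof (induction arbitrary: z rule: transduces.induct)
  case (halt q p u)
  \<comment> \<open>\<open>length u\<close> steps write the output, and one more enters the query
    state.\<close>
  have "(step query_machine X w ^^ Suc (length u)) (snapshot (code (q, 0)) p z) =
      snapshot (query_state query_machine) p (z @ u)"
    using steps_emit[OF halt(2,1,3), of "length u" X z] step_move[OF halt(2,1,3), of X "z @ u"]
    by simp
  then show ?case by blast
next
  case (move q p u q' mv v)
  let ?p = "min (move_pos mv p) (length w + 1)"
  have "(step query_machine X w ^^ Suc (length u)) (snapshot (code (q, 0)) p z) =
      snapshot (code (q', 0)) ?p (z @ u)"
    using steps_emit[OF move(4,1,5), of "length u" X z] step_move[OF move(4,1,5), of X "z @ u"]
    by simp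
  moreover obtain t p' where "(step query_machine X w ^^ t) (snapshot (code (q', 0)) ?p (z @ u)) =
      snapshot (query_state query_machine) p' ((z @ u) @ v)"
    using move.IH[of "z @ u"] closed[OF move(4,1)] by auto
  ultimately have "(step query_machine X w ^^ (t + Suc (length u))) (snapshot (code (q, 0)) p z) =
      snapshot (query_state query_machine) p' (z @ (u @ v))"
    by (simp only: funpow_add comp_apply append_assoc)
  then show ?case by blast
qed

text \<open>One step after the query state is reached, the machine is in its accepting or rejecting
  state.\<close>

lemma query_machine_answer:
  assumes "transduces \<delta> w q0 0 u"
  shows "if u \<in> X then accepts query_machine X w else rejects query_machine X w"
proof -
  obtain t p' where "(step query_machine X w ^^ t) (snapshot (code (q0, 0)) 0 []) =
      snapshot (query_state query_machine) p' u"
    using transduces_steps[OF assms start, of X "[]"] by auto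
  moreover have "initial query_machine = snapshot (code (q0, 0)) 0 []"
    by (simp add: initial_def snapshot_def query_machine_def Let_def)
  moreover have "state (step query_machine X w (snapshot (query_state query_machine) p' u)) =
      (if u \<in> X then accept_state query_machine else reject_state query_machine)"
    by (simp add: step_def snapshot_def query_machine_def Let_def)
  ultimately have "state (config_at query_machine X w (Suc t)) =
      (if u \<in> X then accept_state query_machine else reject_state query_machine)"
    by (simp add: config_at_def)
  then show ?thesis unfolding accepts_def rejects_def by metis
qed

text \<open>The single query lies in the promise of \<open>P'\<close>, so every oracle for
  \<open>P'\<close> answers it correctly. The space constant is 0.\<close>

theorem logspace_turing_reducible:
  assumes yes: "\<And>w. w \<in> yes_words P \<Longrightarrow> \<exists>u. transduces \<delta> w q0 0 u \<and> u \<in> yes_words P'"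
    and no: "\<And>w. w \<in> no_words P \<Longrightarrow> \<exists>u. transduces \<delta> w q0 0 u \<and> u \<in> no_words P'"
  shows "logspace_turing_reducible P P'"
proof -
  have "log_space 0 query_machine X" for X
    unfolding log_space_def by (simp add: work_pos_query_machine)
  moreover have "machine_solves query_machine X P" if "oracle_for X P'" for X
    unfolding machine_solves_def
  proof (intro conjI ballI)
    fix w assume "w \<in> yes_words P"
    from yes[OF this] that show "accepts query_machine X w"
      unfolding oracle_for_def by (metis query_machine_answer subsetD)
  next
    fix w assume "w \<in> no_words P"
    from no[OF this] that show "rejects query_machine X w"
      unfolding oracle_for_def by (metis query_machine_answer disjoint_iff)
  qed
  ultimately show ?thesis
    unfolding logspace_turing_reducible_def using is_machine_query_machine by blast
qed

end

section \<open>Following a run letter by letter\<close>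

lemma read_input_middle: "read_input (pre @ x # post) (Suc (length pre)) = Letter x"
  by (simp add: read_input_def)

text \<open>Position 0 is the left end marker, so the letter after \<open>pre\<close> is at
  \<open>Suc (length pre)\<close>.\<close>

lemma transduces_right:
  assumes "w = pre @ x # post" and "\<delta> q (Letter x) = (u, Some (q', MoveRight))"
    and "transduces \<delta> w q' (Suc (length (pre @ [x]))) v"
  shows "transduces \<delta> w q (Suc (length pre)) (u @ v)"
proof (rule transduces.move)
  show "\<delta> q (read_input w (Suc (length pre))) = (u, Some (q', MoveRight))"
    using assms read_input_middle[of pre x post] by simp
qed (use assms in simp)

lemma transduces_left:
  assumes "w = pre @ x # post" and "\<delta> q (Letter x) = (u, Some (q', MoveLeft))"
    and "transduces \<delta> w q' (length pre) v"
  shows "transduces \<delta> w q (Suc (length pre)) (u @ v)"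
proof (rule transduces.move)
  show "\<delta> q (read_input w (Suc (length pre))) = (u, Some (q', MoveLeft))"
    using assms read_input_middle[of pre x post] by simp
qed (use assms in simp)

lemma transduces_left_end:
  assumes "\<delta> q LeftEnd = ([], Some (q, MoveRight))" and "transduces \<delta> w q 1 v"
  shows "transduces \<delta> w q 0 v"
  using transduces.move[of \<delta> q w 0 "[]" q MoveRight v] assms by (simp add: read_input_def)

lemma transduces_right_end:
  assumes "\<delta> q RightEnd = ([], None)"
  shows "transduces \<delta> w q (Suc (length w)) []"
  by (rule transduces.halt) (simp add: read_input_def assms)

fun copy_transducer :: "unit transducer" where
  "copy_transducer q LeftEnd = ([], Some (q, MoveRight))"
| "copy_transducer q (Letter x) = ([x], Some (q, MoveRight))"
| "copy_transducer q RightEnd = ([], None)"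

lemma copy_transducer_copies: "transduces copy_transducer w () 0 w"
proof -
  \<comment> \<open>Generalised to runs starting at an arbitrary suffix, for the induction.\<close>
  have "w = pre @ post \<Longrightarrow> transduces copy_transducer w () (Suc (length pre)) post" for pre post
  proof (induction post arbitrary: pre)
    case Nil
    then show ?case using transduces_right_end[of copy_transducer "()" w] by simp
  next
    case (Cons x post)
    then have "transduces copy_transducer w () (Suc (length (pre @ [x]))) post" by simp
    with Cons.prems show ?case
      using transduces_right[of w pre x post copy_transducer "()" "[x]"] by simp
  qed
  from this[of "[]" w] show ?thesis
    by (auto intro!: transduces_left_end)
qed

lemma logspace_turing_reducible_identity:
  assumes "yes_words P \<subseteq> yes_words P'" and "no_words P \<subseteq> no_words P'"
  shows "logspace_turing_reducible P P'"
proof -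
  interpret finite_transducer copy_transducer "UNIV :: unit set" "()"
    by unfold_locales auto
  show ?thesis
    by (rule logspace_turing_reducible) (use assms copy_transducer_copies in blast)+
qed

section \<open>Computing the product with a fixed finite structure\<close>

text \<open>\<open>Domain\<close> reads the unary domain size. \<open>Rewind i k\<close> walks back
  to the start of the current tuple, to pair it next with the \<open>k\<close>-th tuple of
  \<open>B\<close>.\<close>

datatype phase = Domain | Forward nat nat nat | Rewind nat nat

context finite_structure
begin

text \<open>This numbering can be written in unary on the fly: \<open>N\<close> ones for each one of
  \<open>a\<close>, and \<open>number b\<close> further ones when the comma is reached.\<close>

definition pair :: "nat \<Rightarrow> 'b \<Rightarrow> nat" where "pair a b = a * N + number b"

text \<open>A tuple of the input is read once for every tuple of \<open>B\<close>, and then once more silently.  In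
  the state \<open>Forward i k j\<close> the transducer is in the \<open>i\<close>-th relation of the input, pairs the
  current tuple with the \<open>k\<close>-th tuple of \<open>B\<close>, and has read \<open>j\<close> entries.\<close>

fun product_transducer :: "phase transducer" where
  "product_transducer q LeftEnd = ([], Some (q, MoveRight))"
| "product_transducer q RightEnd = ([], None)"
| "product_transducer Domain (Letter l) =
    (case l of One \<Rightarrow> (replicate N One, Some (Domain, MoveRight))
     | Bar \<Rightarrow> ([Bar], Some (Forward 0 0 0, MoveRight))
     | _ \<Rightarrow> ([], None))"
| "product_transducer (Forward i k j) (Letter l) =
    (case l of
       One \<Rightarrow> (if k < length (tuples i) then replicate N One else [], Some (Forward i k j, MoveRight))
     | Comma \<Rightarrow>
         if k < length (tuples i) \<and> j < \<tau> ! i then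
           (replicate (number (tuples i ! k ! j)) One @ [Comma], Some (Forward i k (Suc j), MoveRight))
         else ([], Some (Forward i k j, MoveRight))
     | Semicolon \<Rightarrow>
         if k < length (tuples i) then ([Semicolon], Some (Rewind i (Suc k), MoveLeft))
         else ([], Some (Forward i 0 0, MoveRight))
     | Bar \<Rightarrow> if i < length \<tau> then ([Bar], Some (Forward (Suc i) 0 0, MoveRight)) else ([], None))"
| "product_transducer (Rewind i k) (Letter l) =
    ([], Some (if l = One \<or> l = Comma then (Rewind i k, MoveLeft) else (Forward i k 0, MoveRight)))"

text \<open>The index \<open>length \<tau>\<close> is included for the state entered after the last
  relation; \<open>tuples\<close> and the arity are unspecified there but still denote fixed finite
  values. The value \<open>k = length (tuples i)\<close> marks the silent pass.\<close>

definition phases :: "phase set" where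
  "phases = insert Domain (\<Union>i\<le>length \<tau>. \<Union>k\<le>length (tuples i).
     insert (Rewind i k) (Forward i k ` {..\<tau> ! i}))"

lemma phases_iff:
  "Domain \<in> phases"
  "Rewind i k \<in> phases \<longleftrightarrow> i \<le> length \<tau> \<and> k \<le> length (tuples i)"
  "Forward i k j \<in> phases \<longleftrightarrow> i \<le> length \<tau> \<and> k \<le> length (tuples i) \<and> j \<le> \<tau> ! i"
  by (auto simp: phases_def)

lemma finite_transducer_product: "finite_transducer product_transducer phases Domain"
proof
  show "finite phases" by (simp add: phases_def)
  show "Domain \<in> phases" by (rule phases_iff)
  fix q x u q' mv
  assume "q \<in> phases" and "product_transducer q x = (u, Some (q', mv))"
  then show "q' \<in> phases"
    by (cases "(q, x)" rule: product_transducer.cases)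
      (auto simp: phases_iff split: letter.splits if_splits)
qed

section \<open>Runs of the product transducer\<close>

abbreviation outputs :: "word \<Rightarrow> phase \<Rightarrow> nat \<Rightarrow> word \<Rightarrow> bool" where
  "outputs \<equiv> transduces product_transducer"

abbreviation entries :: "nat list \<Rightarrow> word" where
  "entries t \<equiv> concat (map (\<lambda>a. replicate a One @ [Comma]) t)"

lemma set_entries: "set (entries t) \<subseteq> {One, Comma}"
  by auto

lemma output_ones:
  assumes step: "product_transducer q (Letter One) = (replicate n One, Some (q, MoveRight))"
  shows "w = pre @ replicate a One @ post \<Longrightarrow>
    outputs w q (Suc (length (pre @ replicate a One))) v \<Longrightarrow>
    outputs w q (Suc (length pre)) (replicate (a * n) One @ v)"
proof (induction a arbitrary: pre)
  case (Suc a)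
  have "outputs w q (Suc (length (pre @ [One]))) (replicate (a * n) One @ v)"
    by (rule Suc.IH) (use Suc.prems in simp_all)
  from transduces_right[of w pre One _ product_transducer q, OF _ step this] Suc.prems
  show ?case by (simp add: replicate_add)
qed simp

text \<open>Once the tuples of \<open>B\<close> are exhausted, the entries are skipped in order to
  reach the next tuple of the input.\<close>

lemma output_silent:
  assumes k: "k = length (tuples i)"
  shows "set xs \<subseteq> {One, Comma} \<Longrightarrow> w = pre @ xs @ post \<Longrightarrow>
    outputs w (Forward i k j) (Suc (length (pre @ xs))) v \<Longrightarrow>
    outputs w (Forward i k j) (Suc (length pre)) v"
proof (induction xs arbitrary: pre)
  case (Cons x xs)
  have "outputs w (Forward i k j) (Suc (length (pre @ [x]))) v"
    by (rule Cons.IH) (use Cons.prems in simp_all)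
  moreover have "product_transducer (Forward i k j) (Letter x) = ([], Some (Forward i k j, MoveRight))"
    using Cons.prems k by auto
  ultimately show ?case
    using transduces_right[of w pre x "xs @ post" product_transducer "Forward i k j" "[]"] Cons.prems
    by simp
qed simp

text \<open>The letter \<open>y\<close> is the delimiter before the current tuple, where the head
  turns round. The head moves left, hence the induction from the right end of
  \<open>xs\<close>.\<close>

lemma output_rewind:
  assumes y: "y = Semicolon \<or> y = Bar"
  shows "set xs \<subseteq> {One, Comma} \<Longrightarrow> w = pre @ [y] @ xs @ post \<Longrightarrow>
    outputs w (Forward i k 0) (Suc (length (pre @ [y]))) v \<Longrightarrow>
    outputs w (Rewind i k) (length (pre @ [y] @ xs)) v"
proof (induction xs arbitrary: post rule: rev_induct)
  case Nil
  have "product_transducer (Rewind i k) (Letter y) = ([], Some (Forward i k 0, MoveRight))"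
    using y by auto
  with Nil show ?case
    using transduces_right[of w pre y post product_transducer "Rewind i k" "[]" "Forward i k 0" v]
    by simp
next
  case (snoc x xs)
  have "outputs w (Rewind i k) (length (pre @ [y] @ xs)) v"
    by (rule snoc.IH[of "x # post"]) (use snoc.prems in simp_all)
  moreover have "product_transducer (Rewind i k) (Letter x) = ([], Some (Rewind i k, MoveLeft))"
    using snoc.prems by auto
  ultimately show ?case
    using transduces_left[of w "pre @ [y] @ xs" x post product_transducer "Rewind i k" "[]"]
      snoc.prems by simp
qed

text \<open>The counter \<open>j\<close> is the offset into the tuple of \<open>B\<close>, so the
  remaining entries are paired with \<open>drop j\<close> of it.\<close>

lemma output_entries:
  assumes k: "k < length (tuples i)" and s: "length (tuples i ! k) = \<tau> ! i"
  shows "j + length t \<le> \<tau> ! i \<Longrightarrow> w = pre @ entries t @ post \<Longrightarrow>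
    outputs w (Forward i k (j + length t)) (Suc (length (pre @ entries t))) v \<Longrightarrow>
    outputs w (Forward i k j) (Suc (length pre)) (entries (map2 pair t (drop j (tuples i ! k))) @ v)"
proof (induction t arbitrary: pre j)
  case (Cons a t)
  let ?b = "tuples i ! k ! j"
  let ?v = "entries (map2 pair t (drop (Suc j) (tuples i ! k))) @ v"
  let ?pre = "pre @ replicate a One"
  have j: "j < \<tau> ! i" using Cons.prems by simp
  have "outputs w (Forward i k (Suc j)) (Suc (length (?pre @ [Comma]))) ?v"
    by (rule Cons.IH) (use Cons.prems in simp_all)
  moreover have "product_transducer (Forward i k j) (Letter Comma) =
      (replicate (number ?b) One @ [Comma], Some (Forward i k (Suc j), MoveRight))"
    using k j by simp
  ultimately have "outputs w (Forward i k j) (Suc (length ?pre))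
      ((replicate (number ?b) One @ [Comma]) @ ?v)"
    using Cons.prems by (intro transduces_right[of w ?pre Comma "entries t @ post"]) simp_all
  then have "outputs w (Forward i k j) (Suc (length pre))
      (replicate (a * N) One @ (replicate (number ?b) One @ [Comma]) @ ?v)"
    using Cons.prems k by (intro output_ones[of _ _ _ _ _ "Comma # entries t @ post"]) simp_all
  moreover have "drop j (tuples i ! k) = ?b # drop (Suc j) (tuples i ! k)"
    using s j by (simp add: Cons_nth_drop_Suc)
  ultimately show ?case by (simp add: pair_def replicate_add)
qed simp

text \<open>Downward induction on \<open>k\<close>: the base is the silent pass, and each step is a
  writing pass followed by a rewind.\<close>

lemma output_tuple:
  assumes i: "i < length \<tau>" and t: "length t = \<tau> ! i" and y: "y = Semicolon \<or> y = Bar"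
    and w: "w = pre @ [y] @ encode_tuple t @ post"
    and v: "outputs w (Forward i 0 0) (Suc (length (pre @ [y] @ encode_tuple t))) v"
  shows "k \<le> length (tuples i) \<Longrightarrow> outputs w (Forward i k 0) (Suc (length (pre @ [y])))
    (concat (map (\<lambda>s. encode_tuple (map2 pair t s)) (drop k (tuples i))) @ v)"
proof (induction k rule: inc_induct)
  case base
  let ?k = "length (tuples i)"
  \<comment> \<open>In the silent pass the semicolon writes nothing and resets both counters for the
    next tuple.\<close>
  have "outputs w (Forward i ?k 0) (Suc (length ((pre @ [y]) @ entries t))) ([] @ v)"
    by (rule transduces_right[of _ _ Semicolon post])
      (use w v in \<open>simp_all add: encode_tuple_def\<close>)
  then have "outputs w (Forward i ?k 0) (Suc (length (pre @ [y]))) v"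
    using w output_silent[of ?k i "entries t" w "pre @ [y]" "Semicolon # post" 0 v] set_entries
    by (simp add: encode_tuple_def)
  then show ?case by simp
next
  case (step k)
  let ?s = "tuples i ! k"
  let ?v = "concat (map (\<lambda>s. encode_tuple (map2 pair t s)) (drop (Suc k) (tuples i))) @ v"
  have s: "length ?s = \<tau> ! i"
    using is_structureD(1)[OF is_structure i] tuples[OF i] step(2) nth_mem by blast
  have "outputs w (Rewind i (Suc k)) (length (pre @ [y] @ entries t)) ?v"
    using w step.IH by (intro output_rewind[OF y set_entries]) (simp_all add: encode_tuple_def)
  \<comment> \<open>After a writing pass, the semicolon is output and the head turns left onto the
    letter before it.\<close>
  then have "outputs w (Forward i k (0 + length t)) (Suc (length ((pre @ [y]) @ entries t)))
      ([Semicolon] @ ?v)"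
    using w step(2) by (intro transduces_left[of w _ Semicolon post]) (simp_all add: encode_tuple_def)
  then have "outputs w (Forward i k 0) (Suc (length (pre @ [y])))
      (entries (map2 pair t (drop 0 ?s)) @ [Semicolon] @ ?v)"
    using w t by (intro output_entries[OF step(2) s]) (simp_all add: encode_tuple_def)
  moreover have "drop k (tuples i) = ?s # drop (Suc k) (tuples i)"
    using step(2) by (simp add: Cons_nth_drop_Suc)
  ultimately show ?case by (simp add: encode_tuple_def)
qed

text \<open>\<open>List.product\<close> lists the pairs in the order of the run: all tuples of
  \<open>B\<close> for the first input tuple, then for the next.\<close>

definition product_tuples :: "nat \<Rightarrow> nat list list \<Rightarrow> nat list list" where
  "product_tuples i ts = map (\<lambda>(t, s). map2 pair t s) (List.product ts (tuples i))"

lemma product_tuples_Cons: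
  "product_tuples i (t # ts) = map (map2 pair t) (tuples i) @ product_tuples i ts"
  by (simp add: product_tuples_def comp_def)

text \<open>The delimiter \<open>y\<close> is general because the first tuple follows a bar and all
  later ones a semicolon.\<close>

lemma output_tuples:
  assumes i: "i < length \<tau>"
  shows "\<forall>t\<in>set ts. length t = \<tau> ! i \<Longrightarrow> y = Semicolon \<or> y = Bar \<Longrightarrow>
    w = pre @ [y] @ concat (map encode_tuple ts) @ post \<Longrightarrow>
    outputs w (Forward i 0 0) (Suc (length (pre @ [y] @ concat (map encode_tuple ts)))) v \<Longrightarrow>
    outputs w (Forward i 0 0) (Suc (length (pre @ [y])))
      (concat (map encode_tuple (product_tuples i ts)) @ v)"
proof (induction ts arbitrary: pre y)
  case Nil
  then show ?case by (simp add: product_tuples_def)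
next
  case (Cons t ts)
  let ?v = "concat (map encode_tuple (product_tuples i ts)) @ v"
  let ?pre = "pre @ [y] @ entries t"
  have "outputs w (Forward i 0 0) (Suc (length (?pre @ [Semicolon]))) ?v"
    by (rule Cons.IH) (use Cons.prems in \<open>simp_all add: encode_tuple_def\<close>)
  then have "outputs w (Forward i 0 0) (Suc (length (pre @ [y] @ encode_tuple t))) ?v"
    by (simp add: encode_tuple_def)
  from output_tuple[OF i _ Cons.prems(2) _ this, of "concat (map encode_tuple ts) @ post" 0] Cons.prems
  show ?case by (simp add: product_tuples_Cons comp_def)
qed

lemma output_relations:
  assumes len: "length tss = length \<tau>" and t: "\<forall>i<length \<tau>. \<forall>t\<in>set (tss ! i). length t = \<tau> ! i"
  shows "i \<le> length \<tau> \<Longrightarrow> w = pre @ [Bar] @ concat (map encode_relation (drop i tss)) \<Longrightarrow>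
    outputs w (Forward i 0 0) (Suc (length (pre @ [Bar])))
      (concat (map (\<lambda>i. encode_relation (product_tuples i (tss ! i))) [i..<length \<tau>]))"
proof (induction i arbitrary: pre rule: inc_induct)
  case base
  then show ?case
    using len transduces_right_end[of product_transducer "Forward (length \<tau>) 0 0" w] by simp
next
  case (step i)
  let ?ts = "tss ! i"
  let ?rest = "concat (map encode_relation (drop (Suc i) tss))"
  let ?v = "concat (map (\<lambda>i. encode_relation (product_tuples i (tss ! i))) [Suc i..<length \<tau>])"
  let ?pre = "pre @ [Bar] @ concat (map encode_tuple ?ts)"
  have "drop i tss = ?ts # drop (Suc i) tss"
    using step(2) len by (simp add: Cons_nth_drop_Suc)
  with step.prems have w: "w = ?pre @ Bar # ?rest" by (simp add: encode_relation_def[of ?ts])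
  have "outputs w (Forward (Suc i) 0 0) (Suc (length (?pre @ [Bar]))) ?v"
    by (rule step.IH) (simp add: w)
  then have "outputs w (Forward i 0 0) (Suc (length ?pre)) ([Bar] @ ?v)"
    using w step(2) by (intro transduces_right[of w ?pre Bar ?rest]) simp_all
  then have "outputs w (Forward i 0 0) (Suc (length (pre @ [Bar])))
      (concat (map encode_tuple (product_tuples i ?ts)) @ [Bar] @ ?v)"
    using w step(2) t by (intro output_tuples[of i ?ts Bar w pre "Bar # ?rest"]) simp_all
  then show ?case using step(2) by (simp add: upt_rec[of i] encode_relation_def)
qed

lemma output_product:
  assumes "length tss = length \<tau>" and "\<forall>i<length \<tau>. \<forall>t\<in>set (tss ! i). length t = \<tau> ! i"
  shows "outputs (replicate n One @ [Bar] @ concat (map encode_relation tss)) Domain 0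
    (replicate (n * N) One @ [Bar] @
      concat (map encode_relation (map (\<lambda>i. product_tuples i (tss ! i)) [0..<length \<tau>])))"
proof -
  let ?w = "replicate n One @ [Bar] @ concat (map encode_relation tss)"
  let ?v = "concat (map (\<lambda>i. encode_relation (product_tuples i (tss ! i))) [0..<length \<tau>])"
  have "outputs ?w (Forward 0 0 0) (Suc (length (replicate n One @ [Bar]))) ?v"
    by (rule output_relations[OF assms]) simp_all
  then have "outputs ?w Domain (Suc (length (replicate n One))) ([Bar] @ ?v)"
    by (intro transduces_right[of ?w _ Bar "concat (map encode_relation tss)"]) simp_all
  then have "outputs ?w Domain (Suc (length [])) (replicate (n * N) One @ [Bar] @ ?v)"
    using output_ones[of Domain N ?w "[]" n "Bar # concat (map encode_relation tss)" "[Bar] @ ?v"]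
    by simp
  then show ?thesis
    by (intro transduces_left_end) (simp_all add: comp_def)
qed

lemma pair_div_mod: "b \<in> univ B \<Longrightarrow> pair a b div N = a \<and> element (pair a b mod N) = b"
  using number_less[of b] by (simp add: pair_def)

text \<open>Division and remainder by \<open>N\<close> decode both components; equal lengths ensure
  that \<open>map2\<close> truncates neither tuple.\<close>

lemma map_pair:
  assumes "length t = length s" and "set s \<subseteq> univ B"
  shows "map (\<lambda>x. x div N) (map2 pair t s) = t" and "map (\<lambda>x. element (x mod N)) (map2 pair t s) = s"
  using assms by (induction t s rule: list_induct2) (simp_all add: pair_div_mod)

text \<open>\<open>D\<close> is a copy of the product on an initial segment of the naturals,
  numbered by \<open>pair\<close>; decoding and \<open>pair\<close> are the two
  homomorphisms.\<close>

lemma encodes_product: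
  assumes "encodes \<tau> w C"
  shows "\<exists>u D. outputs w Domain 0 u \<and> encodes \<tau> u D \<and> hom_equivalent \<tau> D (struct_product C B)"
proof -
  obtain n tss where C: "is_structure \<tau> C" "univ C = {..<n}" and len: "length tss = length \<tau>"
    and tss: "\<And>i. i < length \<tau> \<Longrightarrow> distinct (tss ! i) \<and> set (tss ! i) = rel C i"
    and w: "w = replicate n One @ [Bar] @ concat (map encode_relation tss)"
    using assms unfolding encodes_def by blast
  define uss where "uss = map (\<lambda>i. product_tuples i (tss ! i)) [0..<length \<tau>]"
  define D where "D = \<lparr>univ = {..<n * N}, rel = (\<lambda>i. set (product_tuples i (tss ! i)))\<rparr>"
  have uss: "set (uss ! i) = {map2 pair t s | t s. t \<in> rel C i \<and> s \<in> rel B i}"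
    and distinct: "distinct (uss ! i)" if i: "i < length \<tau>" for i
  proof -
    have *: "length t = length s \<and> set s \<subseteq> univ B" if "t \<in> rel C i" "s \<in> rel B i" for t s
      using is_structureD[OF C(1) i that(1)] is_structureD[OF is_structure i that(2)] by simp
    have set: "set (List.product (tss ! i) (tuples i)) = rel C i \<times> rel B i"
      using tss[OF i] tuples[OF i] by simp
    then show "set (uss ! i) = {map2 pair t s | t s. t \<in> rel C i \<and> s \<in> rel B i}"
      using i by (auto simp: uss_def product_tuples_def)
    \<comment> \<open>Decoding inverts the pairing of tuples, so the output lists no tuple twice, as
      an encoding requires.\<close>
    have "inj_on (\<lambda>(t, s). map2 pair t s) (rel C i \<times> rel B i)"
    proof (rule inj_on_inverseI)
      fix x assume "x \<in> rel C i \<times> rel B i"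
      then show "(\<lambda>z. (map (\<lambda>x. x div N) z, map (\<lambda>x. element (x mod N)) z))
          ((\<lambda>(t, s). map2 pair t s) x) = x"
        using * map_pair by (auto simp del: map_map)
    qed
    then show "distinct (uss ! i)"
      using i set tss[OF i] tuples[OF i] distinct_product[of "tss ! i" "tuples i"]
      by (simp add: uss_def product_tuples_def distinct_map)
  qed
  have rel_D: "rel D i = set (uss ! i)" if "i < length \<tau>" for i
    using that by (simp add: D_def uss_def)
  have D_in: "set (map2 pair t s) \<subseteq> univ D \<and> length (map2 pair t s) = \<tau> ! i"
    if "i < length \<tau>" "t \<in> rel C i" "s \<in> rel B i" for i t s
  proof -
    have ts: "length t = \<tau> ! i" "set t \<subseteq> {..<n}" "length s = \<tau> ! i" "set s \<subseteq> univ B"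
      using is_structureD[OF C(1) that(1,2)] is_structureD[OF is_structure that(1,3)] C(2) by auto
    have "pair a b < n * N" if "(a, b) \<in> set (zip t s)" for a b
      unfolding pair_def using set_zip_leftD[OF that] set_zip_rightD[OF that] ts
      by (intro mult_add_less number_less) auto
    with ts show ?thesis by (auto simp: D_def)
  qed
  have D: "is_structure \<tau> D"
    unfolding is_structure_def using rel_D uss D_in by fastforce
  have CB: "is_structure \<tau> (struct_product C B)"
    by (rule is_structure_product[OF C(1) is_structure])
  have "outputs w Domain 0 (replicate (n * N) One @ [Bar] @ concat (map encode_relation uss))"
    unfolding w uss_def using len tss is_structureD(1)[OF C(1)] by (intro output_product) auto
  moreover have "encodes \<tau> (replicate (n * N) One @ [Bar] @ concat (map encode_relation uss)) D"
    unfolding encodes_def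
  proof (intro conjI exI)
    show "univ D = {..<n * N}" by (simp add: D_def)
    show "length uss = length \<tau>" by (simp add: uss_def)
    show "\<forall>i<length \<tau>. List.distinct (uss ! i) \<and> set (uss ! i) = rel D i"
      using rel_D distinct by simp
  qed (rule D refl)+
  moreover have "hom_equivalent \<tau> D (struct_product C B)"
    unfolding hom_equivalent_def maps_to_def
  proof (intro conjI exI)
    show "is_hom \<tau> D (struct_product C B) (\<lambda>x. (x div N, element (x mod N)))"
      unfolding is_hom_def
    proof (intro conjI allI impI ballI)
      have "x div N < n \<and> element (x mod N) \<in> univ B" if "x < n * N" for x
        using that by (cases "N = 0") (auto simp: less_mult_imp_div_less intro: element_in)
      then show "(\<lambda>x. (x div N, element (x mod N))) ` univ D \<subseteq> univ (struct_product C B)"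
        using C(2) by (auto simp: D_def struct_product_def)
      fix i z assume i: "i < length \<tau>" and "z \<in> rel D i"
      then obtain t s where z: "z = map2 pair t s" and ts: "t \<in> rel C i" "s \<in> rel B i"
        using rel_D uss by auto
      have "length t = length s" "set s \<subseteq> univ B"
        using is_structureD[OF C(1) i ts(1)] is_structureD[OF is_structure i ts(2)] by simp_all
      from map_pair[OF this] ts
      show "map (\<lambda>x. (x div N, element (x mod N))) z \<in> rel (struct_product C B) i"
        unfolding z by (simp add: struct_product_def comp_def)
    qed
    show "is_hom \<tau> (struct_product C B) D (\<lambda>(a, b). pair a b)"
      unfolding is_hom_def
    proof (intro conjI allI impI ballI)
      show "(\<lambda>(a, b). pair a b) ` univ (struct_product C B) \<subseteq> univ D"
        using C(2) by (auto simp: struct_product_def D_def pair_def intro!: mult_add_less number_less)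
      fix i z assume i: "i < length \<tau>" and "z \<in> rel (struct_product C B) i"
      then have "map fst z \<in> rel C i" "map snd z \<in> rel B i" by (simp_all add: struct_product_def)
      then have "map2 pair (map fst z) (map snd z) \<in> rel D i"
        using rel_D[OF i] uss[OF i] by blast
      then show "map (\<lambda>(a, b). pair a b) z \<in> rel D i" by (simp add: zip_map_fst_snd)
    qed
  qed
  ultimately show ?thesis by blast
qed

text \<open>Under the promise both questions agree, so the instance itself is queried. Conversely,
  the product with \<open>B\<close> meets the promise through its second projection, and the
  adjunction relates the answers.\<close>

theorem RCSP_logspace_turing_equivalent:
  "logspace_turing_equivalent (RCSP \<tau> A B) (CSP \<tau> (exponential \<tau> A B))"
  unfolding logspace_turing_equivalent_def
proof
  have promise: "maps_to \<tau> C (exponential \<tau> A B) \<longleftrightarrow> maps_to \<tau> C A"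
    if "encodes \<tau> w C" "maps_to \<tau> C B" for w C
    using that maps_to_exponential_iff_restricted[OF _ is_structure] unfolding encodes_def by blast
  show "logspace_turing_reducible (RCSP \<tau> A B) (CSP \<tau> (exponential \<tau> A B))"
    by (rule logspace_turing_reducible_identity) (auto simp: RCSP_def CSP_def promise)
  interpret T: finite_transducer product_transducer phases Domain
    by (rule finite_transducer_product)
  have product: "\<exists>u D. outputs w Domain 0 u \<and> encodes \<tau> u D \<and> maps_to \<tau> D B \<and>
      (maps_to \<tau> D A \<longleftrightarrow> maps_to \<tau> C (exponential \<tau> A B))" if C: "encodes \<tau> w C" for w C
  proof -
    from encodes_product[OF C] obtain u D where u: "outputs w Domain 0 u" "encodes \<tau> u D"
      and D: "maps_to \<tau> D (struct_product C B)" "maps_to \<tau> (struct_product C B) D"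
      unfolding hom_equivalent_def by blast
    have "maps_to \<tau> C (exponential \<tau> A B) \<longleftrightarrow> maps_to \<tau> (struct_product C B) A"
      using C maps_to_exponential_iff[OF _ is_structure] unfolding encodes_def by blast
    also have "\<dots> \<longleftrightarrow> maps_to \<tau> D A"
      using maps_to_trans[OF D(1)] maps_to_trans[OF D(2)] by blast
    finally show ?thesis
      using u maps_to_trans[OF D(1) product_maps_to_snd] by blast
  qed
  show "logspace_turing_reducible (CSP \<tau> (exponential \<tau> A B)) (RCSP \<tau> A B)"
    by (rule T.logspace_turing_reducible) (use product in \<open>auto simp: RCSP_def CSP_def, blast+\<close>)
qed

end

theorem theorem22:
  fixes \<tau>\<^sub>1 \<tau>\<^sub>2 :: signature
    and A\<^sub>1 :: "'a rel_structure" and B\<^sub>1 :: "'b rel_structure"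
    and A\<^sub>2 :: "'c rel_structure" and B\<^sub>2 :: "'d rel_structure"
  assumes "restricted_template \<tau>\<^sub>1 (A\<^sub>1, B\<^sub>1)"
    and "restricted_template \<tau>\<^sub>2 (A\<^sub>2, B\<^sub>2)"
    and "finite (univ B\<^sub>1)"
    and "finite (univ B\<^sub>2)"
  shows "(rpp_constructs \<tau>\<^sub>1 (A\<^sub>1, B\<^sub>1) \<tau>\<^sub>2 (A\<^sub>2, B\<^sub>2) \<longleftrightarrow>
            pp_constructs \<tau>\<^sub>1 (exponential \<tau>\<^sub>1 A\<^sub>1 B\<^sub>1) \<tau>\<^sub>2 (exponential \<tau>\<^sub>2 A\<^sub>2 B\<^sub>2)) \<and>
         (rpp_constructs \<tau>\<^sub>1 (A\<^sub>1, B\<^sub>1) \<tau>\<^sub>1 (exponential \<tau>\<^sub>1 A\<^sub>1 B\<^sub>1, loop \<tau>\<^sub>1) \<and>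
          rpp_constructs \<tau>\<^sub>1 (exponential \<tau>\<^sub>1 A\<^sub>1 B\<^sub>1, loop \<tau>\<^sub>1) \<tau>\<^sub>1 (A\<^sub>1, B\<^sub>1)) \<and>
         logspace_turing_equivalent (RCSP \<tau>\<^sub>1 A\<^sub>1 B\<^sub>1) (CSP \<tau>\<^sub>1 (exponential \<tau>\<^sub>1 A\<^sub>1 B\<^sub>1))"
proof -
  have A1: "is_structure \<tau>\<^sub>1 A\<^sub>1" and B1: "is_structure \<tau>\<^sub>1 B\<^sub>1"
    and A2: "is_structure \<tau>\<^sub>2 A\<^sub>2" and B2: "is_structure \<tau>\<^sub>2 B\<^sub>2"
    using assms by simp_all
  let ?E = "exponential \<tau>\<^sub>1 A\<^sub>1 B\<^sub>1"
  let ?E' = "exponential \<tau>\<^sub>1 ?E (loop \<tau>\<^sub>1)"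
  interpret finite_structure \<tau>\<^sub>1 B\<^sub>1 by unfold_locales (fact B1 assms(3))+
  have loop: "finite (univ (loop \<tau>\<^sub>1))" by (simp add: loop_def)
  have E: "is_structure \<tau>\<^sub>1 ?E" by (rule is_structure_exponential)
  \<comment> \<open>The template with the loop has exponential \<open>?E'\<close>. By the
    equivalence, mutual rpp-construction reduces to \<open>?E\<close> and \<open>?E'\<close>
    pp-constructing each other.\<close>
  have "hom_equivalent \<tau>\<^sub>1 ?E' ?E" by (rule exponential_loop[OF E])
  then have "pp_constructs \<tau>\<^sub>1 ?E \<tau>\<^sub>1 ?E'" "pp_constructs \<tau>\<^sub>1 ?E' \<tau>\<^sub>1 ?E"
    by (intro pp_constructs_hom_equivalent is_structure_exponential; simp add: hom_equivalent_sym)+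
  then have "rpp_constructs \<tau>\<^sub>1 (A\<^sub>1, B\<^sub>1) \<tau>\<^sub>1 (?E, loop \<tau>\<^sub>1)"
    "rpp_constructs \<tau>\<^sub>1 (?E, loop \<tau>\<^sub>1) \<tau>\<^sub>1 (A\<^sub>1, B\<^sub>1)"
    using rpp_constructs_iff_pp_constructs_exponential[OF A1 B1 assms(3) E is_structure_loop loop]
      rpp_constructs_iff_pp_constructs_exponential[OF E is_structure_loop loop A1 B1 assms(3)]
    by blast+
  then show ?thesis
    using rpp_constructs_iff_pp_constructs_exponential[OF A1 B1 assms(3) A2 B2 assms(4)]
      RCSP_logspace_turing_equivalent by blast
qed

end
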